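(* Let $A$ be a commutative unital $\mathbb{R}$-algebra, let $\tau$ be a locally multiplicatively convex topology on $A$ generated by a saturated family $\mathcal{F}$ of submultiplicative seminorms on $A$, let $d\ge1$ be an integer, and let $S$ be a $\sum A^{2d}$-module of $A$. If $L:A\to\mathbb{R}$ is a $\tau$-continuous linear functional such that $L(s)\ge0$ for all $s\in S$, then there exists a unique Radon measure $\mu$ on $\mathcal{X}(A)$ such that $$L(a)=\int\hat a\,d\mu\quad\text{for all }a\in A.$$ Moreover, $\mathrm{supp}(\mu)$ is contained in the compact set $\mathcal{K}_S\cap\mathfrak{sp}(\rho)$ for some $\rho\in\mathcal{F}$.
   Context: A submultiplicative seminorm on $A$ is a map $\rho:A\to[0,\infty)$ with $\rho(rx)=|r|\rho(x)$, $\rho(x+y)\le\rho(x)+\rho(y)$, $\rho(xy)\le\rho(x)\rho(y)$ for $r\in\mathbb{R}$, $x,y\in A$. A subset $U\subseteq A$ is an m-set if $U\cdot U\subseteq U$. A locally convex vector space topology on $A$ (not assumed Hausdorff) is locally multiplicatively convex (lmc) if there is a base of neighbourhoods of $0$ consisting of m-sets; equivalently, it is generated by a family of submultiplicative seminorms. A (non-empty) family $\mathcal{F}$ of submultiplicative seminorms is saturated if for all $\rho_1,\rho_2\in\mathcal{F}$ the seminorm $x\mapsto\max\{\rho_1(x),\rho_2(x)\}$ belongs to $\mathcal{F}$; the balls $\{a\in A:\rho(a)<r\}$, $\rho\in\mathcal{F}$, $r>0$, then form a base of neighbourhoods of $0$ for the topology generated by $\mathcal{F}$. $\mathcal{X}(A)$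 denotes the set of all unital $\mathbb{R}$-algebra homomorphisms $A\to\mathbb{R}$, with the topology induced from the product topology on $\mathbb{R}^A$, and $\hat a:\mathcal{X}(A)\to\mathbb{R}$ is $\hat a(\alpha)=\alpha(a)$ for $a\in A$. $\mathfrak{sp}(\rho)$ denotes the set of all $\rho$-continuous $\alpha\in\mathcal{X}(A)$. A $\sum A^{2d}$-module of $A$ is a subset $S\subseteq A$ with $1\in S$, $S+S\subseteq S$ and $a^{2d}\cdot S\subseteq S$ for every $a\in A$. $\mathcal{K}_S:=\{\alpha\in\mathcal{X}(A):\hat a(\alpha)\ge0\text{ for all }a\in S\}$. A Radon measure on a Hausdorff space is a (positive) measure on its Borel $\sigma$-algebra that is locally finite (every point has a neighbourhood of finite measure) and inner regular (the measure of each Borel set is the supremum of the measures of its compact subsets). Writing $L(a)=\int\hat a\,d\mu$ includes that $\hat a$ is $\mu$-integrable. *)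

theory Defs
  imports "HOL-Analysis.Analysis"
begin

(* The sort {real_algebra, comm_ring, comm_monoid_mult} describes commutative unital
   real algebras.  Unlike {real_algebra_1, comm_ring_1} it does not impose 0 \<noteq> 1, so the
   zero algebra is included. *)

definition submult_seminorm :: "('a::real_algebra \<Rightarrow> real) \<Rightarrow> bool" where
  "submult_seminorm \<rho> \<longleftrightarrow>
     (\<forall>x. 0 \<le> \<rho> x) \<and>
     (\<forall>r x. \<rho> (r *\<^sub>R x) = \<bar>r\<bar> * \<rho> x) \<and>
     (\<forall>x y. \<rho> (x + y) \<le> \<rho> x + \<rho> y) \<and>
     (\<forall>x y. \<rho> (x * y) \<le> \<rho> x * \<rho> y)"

definition saturated_family :: "('a::real_algebra \<Rightarrow> real) set \<Rightarrow> bool" where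
  "saturated_family F \<longleftrightarrow>
     F \<noteq> {} \<and> (\<forall>\<rho>\<in>F. submult_seminorm \<rho>) \<and>
     (\<forall>\<rho>\<^sub>1\<in>F. \<forall>\<rho>\<^sub>2\<in>F. (\<lambda>x. max (\<rho>\<^sub>1 x) (\<rho>\<^sub>2 x)) \<in> F)"

(* The open balls around all points form a subbasis; for a non-empty F the underlying
   set of the topology is all of UNIV. *)
definition seminorm_topology :: "('a::real_vector \<Rightarrow> real) set \<Rightarrow> 'a topology" where
  "seminorm_topology F =
     topology_generated_by {{x. \<rho> (x - a) < r} | \<rho> a r. \<rho> \<in> F \<and> 0 < r}"

definition nbhd_of :: "'b topology \<Rightarrow> 'b \<Rightarrow> 'b set \<Rightarrow> bool" where
  "nbhd_of T x V \<longleftrightarrow> V \<subseteq> topspace T \<and> (\<exists>U. openin T U \<and> x \<in> U \<and> U \<subseteq> V)"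

definition vector_space_topology :: "'a::real_vector topology \<Rightarrow> bool" where
  "vector_space_topology \<tau> \<longleftrightarrow>
     topspace \<tau> = UNIV \<and>
     continuous_map (prod_topology \<tau> \<tau>) \<tau> (\<lambda>(x, y). x + y) \<and>
     continuous_map (prod_topology euclideanreal \<tau>) \<tau> (\<lambda>(r, x). r *\<^sub>R x)"

definition locally_convex_topology :: "'a::real_vector topology \<Rightarrow> bool" where
  "locally_convex_topology \<tau> \<longleftrightarrow>
     vector_space_topology \<tau> \<and>
     (\<forall>U. nbhd_of \<tau> 0 U \<longrightarrow> (\<exists>V. nbhd_of \<tau> 0 V \<and> convex V \<and> V \<subseteq> U))"

definition m_set :: "'a::real_algebra set \<Rightarrow> bool" where
  "m_set U \<longleftrightarrow> (\<forall>x\<in>U. \<forall>y\<in>U. x * y \<in> U)"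

definition lmc_topology :: "'a::real_algebra topology \<Rightarrow> bool" where
  "lmc_topology \<tau> \<longleftrightarrow>
     locally_convex_topology \<tau> \<and>
     (\<forall>U. nbhd_of \<tau> 0 U \<longrightarrow> (\<exists>V. nbhd_of \<tau> 0 V \<and> m_set V \<and> V \<subseteq> U))"

definition characters :: "('a::{real_algebra, comm_ring, comm_monoid_mult} \<Rightarrow> real) set" where
  "characters = {\<alpha>. linear \<alpha> \<and> (\<forall>x y. \<alpha> (x * y) = \<alpha> x * \<alpha> y) \<and> \<alpha> 1 = 1}"

definition character_space ::
  "('a::{real_algebra, comm_ring, comm_monoid_mult} \<Rightarrow> real) topology" where
  "character_space = subtopology (powertop_real UNIV) characters"

definition gelfand_spectrum ::
  "('a::{real_algebra, comm_ring, comm_monoid_mult} \<Rightarrow> real) \<Rightarrow> ('a \<Rightarrow> real) set" where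
  "gelfand_spectrum \<rho> =
     {\<alpha> \<in> characters. continuous_map (seminorm_topology {\<rho>}) euclideanreal \<alpha>}"

definition power_module ::
  "nat \<Rightarrow> 'a::{real_algebra, comm_ring, comm_monoid_mult} set \<Rightarrow> bool" where
  "power_module d S \<longleftrightarrow>
     1 \<in> S \<and> (\<forall>s\<in>S. \<forall>t\<in>S. s + t \<in> S) \<and> (\<forall>a. \<forall>s\<in>S. a ^ (2 * d) * s \<in> S)"

definition nonneg_characters ::
  "'a::{real_algebra, comm_ring, comm_monoid_mult} set \<Rightarrow> ('a \<Rightarrow> real) set" where
  "nonneg_characters S = {\<alpha> \<in> characters. \<forall>a\<in>S. 0 \<le> \<alpha> a}"

definition radon_measure :: "'b topology \<Rightarrow> 'b measure \<Rightarrow> bool" where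
  "radon_measure T \<mu> \<longleftrightarrow>
     space \<mu> = topspace T \<and>
     sets \<mu> = sigma_sets (topspace T) {U. openin T U} \<and>
     (\<forall>x\<in>topspace T. \<exists>U. openin T U \<and> x \<in> U \<and> emeasure \<mu> U < \<infinity>) \<and>
     (\<forall>B\<in>sets \<mu>. emeasure \<mu> B = (SUP K\<in>{K. compactin T K \<and> K \<subseteq> B}. emeasure \<mu> K))"

definition measure_support :: "'b topology \<Rightarrow> 'b measure \<Rightarrow> 'b set" where
  "measure_support T \<mu> =
     {x \<in> topspace T. \<forall>U. openin T U \<and> x \<in> U \<longrightarrow> 0 < emeasure \<mu> U}"

definition represented_by :: "('a \<Rightarrow> real) \<Rightarrow> ('a \<Rightarrow> real) measure \<Rightarrow> bool" where
  "represented_by L \<mu> \<longleftrightarrow>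
     (\<forall>a. integrable \<mu> (\<lambda>\<alpha>. \<alpha> a) \<and> L a = (\<integral>\<alpha>. \<alpha> a \<partial>\<mu>))"

end

theory Submission
  imports Defs
begin

text \<open>
  Continuity of \<open>L\<close> means \<open>\<bar>L x\<bar> \<le> C * \<rho> x\<close> for a single \<open>\<rho> \<in> F\<close>, because \<open>F\<close> is closed under maxima,
  so everything happens over the compact set \<open>K\<close> of characters that are nonnegative on \<open>S\<close> and
  dominated by \<open>\<rho>\<close>. (A \<open>\<rho>\<close>-continuous character is automatically dominated by \<open>\<rho>\<close>.)

  The algebra enters through one fact: if \<open>\<rho> a < 1\<close> then \<open>1 + a\<close> is a \<open>\<rho>\<close>-limit of \<open>2d\<close>-th powers,
  namely of the \<open>2d\<close>-th powers of the partial sums of the binomial series for \<open>(1 + a)\<close> to the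
  power \<open>1/(2d)\<close>. Hence a continuous functional that is nonnegative on \<open>S\<close> stays nonnegative on
  \<open>(1 + a) * S\<close> (\<open>functional_one_plus_nonneg\<close>). So \<open>1 + a\<close> and \<open>1 - a\<close> both act as positive
  multipliers, and two consequences follow. First, \<open>\<bar>L a\<bar> \<le> L 1 * \<rho> a\<close> (\<open>functional_bound\<close>), so the
  normalised functionals of this kind form a compact convex set. Second, an extreme point \<open>\<phi>\<close> of
  that set is multiplicative: \<open>\<phi>\<close> is a convex combination of the normalisations of
  \<open>x \<mapsto> \<phi> ((1 + a) * x)\<close> and \<open>x \<mapsto> \<phi> ((1 - a) * x)\<close>, which therefore both equal \<open>\<phi>\<close>
  (\<open>extreme_state_multiplicative\<close>). A Krein--Milman argument finds an extreme point among the
  minimisers of evaluation at a given \<open>b\<close>. This shows that \<open>L b \<ge> 0\<close> whenever \<open>\<alpha> b \<ge> 0\<close> for all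
  \<open>\<alpha> \<in> K\<close> (\<open>functional_nonneg_of_nonneg_on_characters\<close>).

  Consequently \<open>L\<close> induces a positive functional on the functions \<open>\<alpha> \<mapsto> \<alpha> a\<close> on \<open>K\<close>; these are uniformly
  dense among the continuous functions by Stone--Weierstrass, and the Riesz representation theorem
  for compact Hausdorff spaces gives \<open>\<mu>\<close> (\<open>represented_by_measure_on_compact\<close>).

  For uniqueness, the bound \<open>L (a ^ (2 * n)) \<le> C' * \<rho> a ^ (2 * n)\<close> on the moments of an arbitrary
  representing Radon measure forces \<open>\<bar>\<alpha> a\<bar> \<le> \<rho> a\<close> almost everywhere for each \<open>a\<close>, and inner regularity
  removes the uncountable union of the exceptional sets (\<open>representing_measure_concentrated\<close>). All
  representing measures therefore live on one compact set, where Stone--Weierstrass and Urysohn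
  functions determine them (\<open>concentrated_representing_measures_eq\<close>). In particular each of them
  is the constructed \<open>\<mu>\<close>, whose support lies in \<open>K\<close>.
\<close>

section \<open>Radon measures from positive functionals\<close>

text \<open>The functional is given on all functions, with hypotheses only for those continuous on the space;
  monotonicity then makes its value depend only on the restriction to the space.\<close>
locale positive_functional =
  fixes X :: "'b topology" and \<Lambda> :: "('b \<Rightarrow> real) \<Rightarrow> real"
  assumes compact_space: "compact_space X"
    and Hausdorff_space: "Hausdorff_space X"
    and functional_add: "\<And>f g. continuous_map X euclideanreal f \<Longrightarrow> continuous_map X euclideanreal g \<Longrightarrow>
      \<Lambda> (\<lambda>x. f x + g x) = \<Lambda> f + \<Lambda> g"
    and functional_scale: "\<And>c f. continuous_map X euclideanreal f \<Longrightarrow> \<Lambda> (\<lambda>x. c * f x) = c * \<Lambda> f"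
    and functional_mono: "\<And>f g. continuous_map X euclideanreal f \<Longrightarrow> continuous_map X euclideanreal g \<Longrightarrow>
      (\<And>x. x \<in> topspace X \<Longrightarrow> f x \<le> g x) \<Longrightarrow> \<Lambda> f \<le> \<Lambda> g"
begin

text \<open>Functions that vanish off \<open>U\<close> are used instead of functions with compact support in \<open>U\<close>: the
  two give the same supremum, as \<open>inner_shrink\<close> shows, and vanishing is easier to check.\<close>
definition inner_functions :: "'b set \<Rightarrow> ('b \<Rightarrow> real) set" where
  "inner_functions U = {f. continuous_map X euclideanreal f \<and>
     (\<forall>x\<in>topspace X. 0 \<le> f x \<and> f x \<le> 1) \<and> (\<forall>x\<in>topspace X - U. f x = 0)}"

definition open_content :: "'b set \<Rightarrow> ennreal" where
  "open_content U = (SUP f\<in>inner_functions U. ennreal (\<Lambda> f))"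

definition outer_content :: "'b set \<Rightarrow> ennreal" where
  "outer_content E = (INF U\<in>{U. openin X U \<and> E \<subseteq> U}. open_content U)"

definition riesz_measure :: "'b measure" where
  "riesz_measure = measure_of (topspace X) {U. openin X U} outer_content"

lemma functional_zero: "\<Lambda> (\<lambda>x. 0) = 0"
  using functional_scale[of "\<lambda>x. 0" 0] by simp

lemma functional_nonneg:
  assumes "continuous_map X euclideanreal f" "\<And>x. x \<in> topspace X \<Longrightarrow> 0 \<le> f x"
  shows "0 \<le> \<Lambda> f"
  using functional_mono[of "\<lambda>x. 0" f] assms functional_zero by simp

lemma functional_cong:
  assumes "continuous_map X euclideanreal f" "continuous_map X euclideanreal g"
    "\<And>x. x \<in> topspace X \<Longrightarrow> f x = g x"
  shows "\<Lambda> f = \<Lambda> g"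
  by (intro antisym functional_mono) (use assms in auto)

lemma functional_sum:
  assumes "finite I" "\<And>i. i \<in> I \<Longrightarrow> continuous_map X euclideanreal (f i)"
  shows "\<Lambda> (\<lambda>x. \<Sum>i\<in>I. f i x) = (\<Sum>i\<in>I. \<Lambda> (f i))"
  using assms
proof (induction I)
  case (insert i I)
  then show ?case
    using functional_add[of "f i" "\<lambda>x. \<Sum>i\<in>I. f i x"] by (simp add: continuous_map_sum)
qed (simp add: functional_zero)

lemma normal: "normal_space X"
  using compact_Hausdorff_or_regular_imp_normal_space compact_space Hausdorff_space by blast

lemma inner_functionsD:
  assumes "f \<in> inner_functions U"
  shows "continuous_map X euclideanreal f"
    and "\<And>x. x \<in> topspace X \<Longrightarrow> 0 \<le> f x" and "\<And>x. x \<in> topspace X \<Longrightarrow> f x \<le> 1"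
    and "\<And>x. x \<in> topspace X \<Longrightarrow> x \<notin> U \<Longrightarrow> f x = 0" and "0 \<le> \<Lambda> f"
  using assms functional_nonneg[of f] by (auto simp: inner_functions_def)

lemma inner_functions_mono: "U \<inter> topspace X \<subseteq> V \<Longrightarrow> inner_functions U \<subseteq> inner_functions V"
  by (auto simp: inner_functions_def)

lemma zero_inner: "(\<lambda>x. 0) \<in> inner_functions U"
  by (auto simp: inner_functions_def)

lemma open_content_upper: "f \<in> inner_functions U \<Longrightarrow> ennreal (\<Lambda> f) \<le> open_content U"
  unfolding open_content_def by (rule SUP_upper)

lemma open_content_mono: "U \<subseteq> V \<Longrightarrow> open_content U \<le> open_content V"
  unfolding open_content_def by (intro SUP_subset_mono inner_functions_mono) auto

lemma open_content_le: "open_content U \<le> ennreal (\<Lambda> (\<lambda>x. 1))"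
  unfolding open_content_def
  by (intro SUP_least ennreal_leI functional_mono) (auto dest: inner_functionsD)

lemma open_content_empty: "open_content {} = 0"
proof -
  have "\<Lambda> f = 0" if "f \<in> inner_functions {}" for f
    using functional_cong[of f "\<lambda>x. 0"] inner_functionsD[OF that] functional_zero by auto
  then show ?thesis
    unfolding open_content_def using zero_inner[of "{}"] by (auto simp: SUP_constant)
qed

text \<open>Subtracting a small constant and taking the positive part moves the support of a function into
  a closed, hence compact, subset of \<open>U\<close>, at an arbitrarily small cost. Every compactness argument
  below starts with this step.\<close>
lemma inner_shrink:
  assumes f: "f \<in> inner_functions U" and e: "0 < e"
  obtains g C where "g \<in> inner_functions C" "closedin X C" "C \<subseteq> U" "\<Lambda> f \<le> \<Lambda> g + e"
proof -
  note f' = inner_functionsD[OF f]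
  define M where "M = \<Lambda> (\<lambda>x. 1)"
  have M: "0 \<le> M" unfolding M_def by (intro functional_nonneg) auto
  \<comment> \<open>The cut-off level is chosen so that lowering the function by it costs at most \<open>e\<close>; the
    \<open>+ 1\<close> keeps it positive when the total mass \<open>M\<close> vanishes.\<close>
  define d where "d = e / (M + 1)"
  have d: "0 < d" "d * M \<le> e" using e M by (auto simp: d_def divide_simps algebra_simps)
  define C where "C = {x \<in> topspace X. d \<le> f x}"
  define g where "g = (\<lambda>x. max (f x - d) 0)"
  have g: "continuous_map X euclideanreal g"
    unfolding g_def by (intro continuous_map_real_max continuous_map_diff f') auto
  have "g \<in> inner_functions C"
    unfolding inner_functions_def
  proof (safe intro!: g)
    fix x assume x: "x \<in> topspace X"
    show "0 \<le> g x" "g x \<le> 1" using f'(2,3)[OF x] d by (auto simp: g_def)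
    assume "x \<notin> C" then show "g x = 0" using x by (auto simp: C_def g_def)
  qed
  moreover have "closedin X C"
    using closedin_continuous_map_preimage[OF f'(1), of "{d..}"] by (simp add: C_def)
  moreover have "C \<subseteq> U"
    using f'(4) d by (force simp: C_def)
  moreover have "\<Lambda> f \<le> \<Lambda> (\<lambda>x. g x + d * 1)"
    by (intro functional_mono f' continuous_map_add g) (auto simp: g_def)
  then have "\<Lambda> f \<le> \<Lambda> g + e"
    using functional_add[OF g, of "\<lambda>x. d * 1"] functional_scale[of "\<lambda>x. 1" d] d
    by (simp add: M_def)
  ultimately show thesis by (rule that)
qed

text \<open>A function supported in a closed \<open>C \<subseteq> U \<union> V\<close> splits by means of a Urysohn function that is \<open>1\<close> on
  \<open>C - V\<close> and \<open>0\<close> off \<open>U\<close>.\<close>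
lemma open_content_Un:
  assumes U: "openin X U" and V: "openin X V"
  shows "open_content (U \<union> V) \<le> open_content U + open_content V"
  unfolding open_content_def[of "U \<union> V"]
proof (rule SUP_least, rule ennreal_le_epsilon)
  fix f and e :: real assume f: "f \<in> inner_functions (U \<union> V)" and e: "0 < e"
  obtain g C where g: "g \<in> inner_functions C" "closedin X C" "C \<subseteq> U \<union> V" "\<Lambda> f \<le> \<Lambda> g + e"
    by (rule inner_shrink[OF f e])
  note g' = inner_functionsD[OF g(1)]
  have 1: "closedin X (C - V)" "closedin X (topspace X - U)"
    using g(2) U V by auto
  have 2: "disjnt (topspace X - U) (C - V)"
    using g(3) by (auto simp: disjnt_def)
  obtain h where h: "continuous_map X (top_of_set {0..1::real}) h" "h ` (topspace X - U) \<subseteq> {0}" "h ` (C - V) \<subseteq> {1}"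
    using Urysohn_lemma[OF normal 1(2,1) 2, of 0 1] by auto
  have hc: "continuous_map X euclideanreal h" and h01: "\<And>x. x \<in> topspace X \<Longrightarrow> 0 \<le> h x \<and> h x \<le> 1"
    using h(1) by (auto simp: continuous_map_in_subtopology)
  have gh: "(\<lambda>x. g x * h x) \<in> inner_functions U"
    using g' h h01 by (auto simp: inner_functions_def intro!: continuous_map_real_mult hc mult_le_one)
  have gh': "(\<lambda>x. g x * (1 - h x)) \<in> inner_functions V"
    unfolding inner_functions_def
  proof (safe intro!: continuous_map_real_mult continuous_map_diff hc g')
    fix x assume x: "x \<in> topspace X"
    show "0 \<le> g x * (1 - h x)" "g x * (1 - h x) \<le> 1"
      using g'(2,3)[OF x] h01[OF x] by (auto intro!: mult_le_one)
    assume "x \<notin> V"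
    with h(3) g'(4)[OF x] show "g x * (1 - h x) = 0" by (cases "x \<in> C") auto
  qed auto
  have "\<Lambda> g = \<Lambda> (\<lambda>x. g x * h x + g x * (1 - h x))"
    by (simp add: algebra_simps)
  also have "\<dots> = \<Lambda> (\<lambda>x. g x * h x) + \<Lambda> (\<lambda>x. g x * (1 - h x))"
    using gh gh' by (intro functional_add) (auto dest: inner_functionsD)
  finally have "ennreal (\<Lambda> f) \<le> ennreal (\<Lambda> (\<lambda>x. g x * h x)) + ennreal (\<Lambda> (\<lambda>x. g x * (1 - h x))) + ennreal e"
    using g(4) e inner_functionsD(5)[OF gh] inner_functionsD(5)[OF gh']
    by (simp add: ennreal_plus[symmetric] ennreal_leI del: ennreal_plus)
  also have "\<dots> \<le> open_content U + open_content V + ennreal e"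
    by (intro add_mono open_content_upper gh gh') auto
  finally show "ennreal (\<Lambda> f) \<le> open_content U + open_content V + ennreal e" .
qed

lemma open_content_UN_lessThan:
  fixes U :: "nat \<Rightarrow> 'b set"
  assumes U: "\<And>i. openin X (U i)"
  shows "open_content (\<Union>i<n. U i) \<le> (\<Sum>i<n. open_content (U i))"
proof (induction n)
  case (Suc n)
  have "(\<Union>i<Suc n. U i) = (\<Union>i<n. U i) \<union> U n" by (auto simp: less_Suc_eq)
  then have "open_content (\<Union>i<Suc n. U i) \<le> open_content (\<Union>i<n. U i) + open_content (U n)"
    using U by (auto intro!: open_content_Un)
  also have "\<dots> \<le> (\<Sum>i<Suc n. open_content (U i))"
    using Suc by (auto intro!: add_mono)
  finally show ?case .
qed (simp add: open_content_empty)

lemma open_content_UN: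
  fixes U :: "nat \<Rightarrow> 'b set"
  assumes U: "\<And>i. openin X (U i)"
  shows "open_content (\<Union>i. U i) \<le> (\<Sum>i. open_content (U i))"
  unfolding open_content_def[of "\<Union>i. U i"]
proof (rule SUP_least, rule ennreal_le_epsilon)
  fix f and e :: real assume f: "f \<in> inner_functions (\<Union>i. U i)" and e: "0 < e"
  obtain g C where g: "g \<in> inner_functions C" "closedin X C" "C \<subseteq> (\<Union>i. U i)" "\<Lambda> f \<le> \<Lambda> g + e"
    by (rule inner_shrink[OF f e])
  have "compactin X C"
    using g(2) compact_space closedin_compact_space by blast
  then obtain \<F> where F: "finite \<F>" "\<F> \<subseteq> range U" "C \<subseteq> \<Union>\<F>"
    using g(3) U unfolding compactin_def by (auto 0 4 dest!: spec[of _ "range U"])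
  then obtain I where I: "finite I" "\<F> = U ` I"
    by (meson finite_subset_image)
  then obtain n where "I \<subseteq> {..<n}"
    by (meson finite_nat_iff_bounded)
  then have "C \<subseteq> (\<Union>i<n. U i)" using F I by blast
  then have gU: "g \<in> inner_functions (\<Union>i<n. U i)"
    using inner_functions_mono[of C] g(1) by blast
  have "ennreal (\<Lambda> f) \<le> ennreal (\<Lambda> g) + ennreal e"
    using g(4) e inner_functionsD(5)[OF g(1)]
    by (simp add: ennreal_plus[symmetric] ennreal_leI del: ennreal_plus)
  also have "ennreal (\<Lambda> g) \<le> open_content (\<Union>i<n. U i)"
    by (rule open_content_upper[OF gU])
  also have "\<dots> \<le> (\<Sum>i<n. open_content (U i))"
    by (rule open_content_UN_lessThan[OF U])
  also have "\<dots> \<le> (\<Sum>i. open_content (U i))"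
    by (intro sum_le_suminf) auto
  finally show "ennreal (\<Lambda> f) \<le> (\<Sum>i. open_content (U i)) + ennreal e"
    by (simp add: add_right_mono)
qed

lemma outer_content_open: "openin X U \<Longrightarrow> outer_content U = open_content U"
  unfolding outer_content_def
  by (intro antisym INF_greatest INF_lower2[of U]) (auto intro: open_content_mono)

lemma outer_content_mono: "E \<subseteq> E' \<Longrightarrow> outer_content E \<le> outer_content E'"
  unfolding outer_content_def by (intro INF_superset_mono) auto

lemma outer_content_approx:
  assumes E: "E \<subseteq> topspace X" and e: "0 < e"
  obtains U where "openin X U" "E \<subseteq> U" "open_content U \<le> outer_content E + ennreal e"
proof -
  have "outer_content E \<le> ennreal (\<Lambda> (\<lambda>x. 1))"
    using E open_content_le unfolding outer_content_def by (intro INF_lower2[of "topspace X"]) auto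
  then have "outer_content E < outer_content E + ennreal e"
    using e by (auto simp: top_unique)
  then obtain U where "openin X U" "E \<subseteq> U" "open_content U < outer_content E + ennreal e"
    unfolding outer_content_def[of E] INF_less_iff by auto
  then show thesis using that by (meson less_imp_le)
qed

lemma outer_measure_space_outer_content:
  "outer_measure_space (Pow (topspace X)) outer_content"
  unfolding outer_measure_space_def
proof (intro conjI)
  show "positive (Pow (topspace X)) outer_content"
    by (simp add: positive_def outer_content_open open_content_empty)
  show "increasing (Pow (topspace X)) outer_content"
    by (auto simp: increasing_def outer_content_mono)
  show "countably_subadditive (Pow (topspace X)) outer_content"
    unfolding countably_subadditive_def
  proof (intro allI impI, rule ennreal_le_epsilon)
    fix A :: "nat \<Rightarrow> 'b set" and e :: real
    assume A: "range A \<subseteq> Pow (topspace X)" and e: "0 < e"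
    have "\<exists>U. openin X U \<and> A n \<subseteq> U \<and> open_content U \<le> outer_content (A n) + ennreal (e * (1/2)^Suc n)" for n
      using outer_content_approx[of "A n" "e * (1/2)^Suc n"] A e by (metis (no_types, lifting) PowD
        half_gt_zero_iff mult_pos_pos rangeI subsetD zero_less_one zero_less_power)
    then obtain U where U: "\<And>n. openin X (U n)" "\<And>n. A n \<subseteq> U n"
      "\<And>n. open_content (U n) \<le> outer_content (A n) + ennreal (e * (1/2)^Suc n)"
      by metis
    have "outer_content (\<Union>i. A i) \<le> outer_content (\<Union>i. U i)"
      using U(2) by (intro outer_content_mono) blast
    also have "\<dots> = open_content (\<Union>i. U i)"
      using U(1) by (intro outer_content_open) auto
    also have "\<dots> \<le> (\<Sum>i. open_content (U i))"
      by (rule open_content_UN[OF U(1)])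
    also have "\<dots> \<le> (\<Sum>i. outer_content (A i) + ennreal (e * (1/2)^Suc i))"
      by (intro suminf_le U) auto
    also have "\<dots> = (\<Sum>i. outer_content (A i)) + (\<Sum>i. ennreal (e * (1/2)^Suc i))"
      by (intro suminf_add[symmetric]) auto
    also have "(\<Sum>i. ennreal (e * (1/2)^Suc i)) = ennreal e"
      using e sums_mult[OF power_half_series, of e] by (intro suminf_ennreal_eq) auto
    finally show "outer_content (\<Union>i. A i) \<le> (\<Sum>i. outer_content (A i)) + ennreal e" .
  qed
qed

text \<open>The Caratheodory condition for open sets. Given an open \<open>V \<supseteq> E\<close>, a nearly optimal function for
  \<open>U \<inter> V\<close> is supported in a closed \<open>C\<close>; every competitor for \<open>V - C\<close> is disjointly supported, so the
  sum of the two is a competitor for \<open>V\<close>, and \<open>V - C\<close> still covers \<open>E - U\<close>.\<close>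
lemma outer_content_split:
  assumes U: "openin X U"
  shows "outer_content (E \<inter> U) + outer_content (E - U) \<le> outer_content E"
  unfolding outer_content_def[of E]
proof (intro INF_greatest, clarify)
  fix V assume V: "openin X V" "E \<subseteq> V"
  have "open_content (U \<inter> V) + outer_content (E - U) \<le> open_content V"
    unfolding open_content_def[of "U \<inter> V"]
  proof (subst ennreal_SUP_add_left[symmetric])
    show "inner_functions (U \<inter> V) \<noteq> {}" using zero_inner by auto
    show "(SUP f\<in>inner_functions (U \<inter> V). ennreal (\<Lambda> f) + outer_content (E - U)) \<le> open_content V"
    proof (rule SUP_least, rule ennreal_le_epsilon)
      fix f and e :: real assume f: "f \<in> inner_functions (U \<inter> V)" and e: "0 < e"
      obtain g C where g: "g \<in> inner_functions C" "closedin X C" "C \<subseteq> U \<inter> V" "\<Lambda> f \<le> \<Lambda> g + e"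
        by (rule inner_shrink[OF f e])
      note g' = inner_functionsD[OF g(1)]
      have VC: "openin X (V - C)" using V g(2) by auto
      have "outer_content (E - U) \<le> outer_content (V - C)"
        using V g(3) by (intro outer_content_mono) auto
      also have "\<dots> = open_content (V - C)" by (rule outer_content_open[OF VC])
      finally have 1: "outer_content (E - U) \<le> open_content (V - C)" .
      have "ennreal (\<Lambda> g) + open_content (V - C) \<le> open_content V"
        unfolding open_content_def[of "V - C"]
      proof (subst ennreal_SUP_add_right)
        show "inner_functions (V - C) \<noteq> {}" using zero_inner by auto
        show "(SUP h\<in>inner_functions (V - C). ennreal (\<Lambda> g) + ennreal (\<Lambda> h)) \<le> open_content V"
        proof (rule SUP_least)
          fix h assume h: "h \<in> inner_functions (V - C)"
          note h' = inner_functionsD[OF h]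
          have "(\<lambda>x. g x + h x) \<in> inner_functions V"
            unfolding inner_functions_def
          proof (safe intro!: continuous_map_add g' h')
            fix x assume x: "x \<in> topspace X"
            show "0 \<le> g x + h x" using g'(2)[OF x] h'(2)[OF x] by simp
            show "g x + h x \<le> 1"
              using g'(3,4)[OF x] h'(3,4)[OF x] by (cases "x \<in> C") auto
            assume "x \<notin> V"
            then show "g x + h x = 0" using g'(4)[OF x] h'(4)[OF x] g(3) by auto
          qed
          from open_content_upper[OF this]
          show "ennreal (\<Lambda> g) + ennreal (\<Lambda> h) \<le> open_content V"
            using functional_add[OF g'(1) h'(1)] g'(5) h'(5) by simp
        qed
      qed
      with 1 have 2: "ennreal (\<Lambda> g) + outer_content (E - U) \<le> open_content V"
        by (meson add_left_mono order_trans)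
      have "ennreal (\<Lambda> f) \<le> ennreal (\<Lambda> g) + ennreal e"
        using g(4) e g'(5) by (simp add: ennreal_plus[symmetric] ennreal_leI del: ennreal_plus)
      then have "ennreal (\<Lambda> f) + outer_content (E - U) \<le> ennreal (\<Lambda> g) + outer_content (E - U) + ennreal e"
        by (metis add.assoc add.commute add_right_mono)
      also have "\<dots> \<le> open_content V + ennreal e"
        using 2 by (rule add_right_mono)
      finally show "ennreal (\<Lambda> f) + outer_content (E - U) \<le> open_content V + ennreal e" .
    qed
  qed
  moreover have "outer_content (E \<inter> U) \<le> outer_content (U \<inter> V)"
    using V by (intro outer_content_mono) auto
  moreover have "outer_content (U \<inter> V) = open_content (U \<inter> V)"
    using U V by (intro outer_content_open) auto
  ultimately show "outer_content (E \<inter> U) + outer_content (E - U) \<le> open_content V"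
    by (metis add_right_mono order_trans)
qed

lemma measure_space_riesz:
  "measure_space (topspace X) (sigma_sets (topspace X) {U. openin X U}) outer_content"
proof -
  define ls where "ls = lambda_system (topspace X) (Pow (topspace X)) outer_content"
  have mls: "measure_space (topspace X) ls outer_content"
    using sigma_algebra.caratheodory_lemma[OF sigma_algebra_Pow outer_measure_space_outer_content]
    by (simp add: ls_def)
  then have sls: "sigma_algebra (topspace X) ls"
    by (simp add: measure_space_def)
  have "U \<in> ls" if U: "openin X U" for U
  proof -
    have "outer_content (E \<inter> U) + outer_content (E - U) = outer_content E" if "E \<subseteq> topspace X" for E
    proof (rule antisym[OF outer_content_split[OF U]])
      interpret ps: algebra "topspace X" "Pow (topspace X)" by (rule algebra_Pow)
      have "subadditive (Pow (topspace X)) outer_content"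
        using outer_measure_space_outer_content ps.countably_subadditive_subadditive
        unfolding outer_measure_space_def by blast
      then have "outer_content ((E \<inter> U) \<union> (E - U)) \<le> outer_content (E \<inter> U) + outer_content (E - U)"
        using that by (intro subadditiveD[of "Pow (topspace X)"]) auto
      moreover have "(E \<inter> U) \<union> (E - U) = E" by auto
      ultimately show "outer_content E \<le> outer_content (E \<inter> U) + outer_content (E - U)" by simp
    qed
    then show ?thesis
      using openin_subset[OF U] by (simp add: ls_def algebra.lambda_system_eq[OF algebra_Pow])
  qed
  then have "sigma_sets (topspace X) {U. openin X U} \<subseteq> ls"
    by (intro sigma_algebra.sigma_sets_subset[OF sls]) auto
  then show ?thesis
    by (intro measure_down[OF mls] sigma_algebra_sigma_sets) (auto dest: openin_subset)
qed

lemma opens_Pow: "{U. openin X U} \<subseteq> Pow (topspace X)"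
  by (auto dest: openin_subset)

lemma space_riesz [simp]: "space riesz_measure = topspace X"
  by (simp add: riesz_measure_def space_measure_of opens_Pow)

lemma sets_riesz [simp]: "sets riesz_measure = sigma_sets (topspace X) {U. openin X U}"
  by (simp add: riesz_measure_def sets_measure_of opens_Pow)

lemma emeasure_riesz:
  "B \<in> sigma_sets (topspace X) {U. openin X U} \<Longrightarrow> emeasure riesz_measure B = outer_content B"
  using measure_space_riesz
  by (intro emeasure_measure_of[OF riesz_measure_def]) (auto simp: opens_Pow measure_space_def)

lemma finite_measure_riesz: "finite_measure riesz_measure"
proof
  have "emeasure riesz_measure (space riesz_measure) = open_content (topspace X)"
    by (simp add: emeasure_riesz outer_content_open sigma_sets_top)
  then show "emeasure riesz_measure (space riesz_measure) \<noteq> \<infinity>"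
    using open_content_le[of "topspace X"] by (auto simp: top_unique)
qed

text \<open>Outer regularity holds by construction. As the measure is finite and closed sets are compact, it
  turns into inner regularity on passing to complements.\<close>
lemma emeasure_riesz_inner_regular:
  assumes B: "B \<in> sets riesz_measure"
  shows "emeasure riesz_measure B = (SUP K\<in>{K. compactin X K \<and> K \<subseteq> B}. emeasure riesz_measure K)"
proof (rule antisym)
  interpret finite_measure riesz_measure by (rule finite_measure_riesz)
  have BX: "B \<subseteq> topspace X" using sets.sets_into_space[OF B] by simp
  show "(SUP K\<in>{K. compactin X K \<and> K \<subseteq> B}. emeasure riesz_measure K) \<le> emeasure riesz_measure B"
    using B by (intro SUP_least emeasure_mono) auto
  show "emeasure riesz_measure B \<le> (SUP K\<in>{K. compactin X K \<and> K \<subseteq> B}. emeasure riesz_measure K)"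
  proof (rule ennreal_le_epsilon)
    fix e :: real assume e: "0 < e"
    have cB: "topspace X - B \<in> sets riesz_measure"
      using sets.compl_sets[OF B] by simp
    obtain U where U: "openin X U" "topspace X - B \<subseteq> U"
      "open_content U \<le> outer_content (topspace X - B) + ennreal e"
      by (rule outer_content_approx[of "topspace X - B", OF _ e]) auto
    have Us: "U \<in> sets riesz_measure" using U(1) by (simp add: sigma_sets.Basic)
    have K: "compactin X (topspace X - U)"
      using U(1) compact_space closedin_compact_space by blast
    have Ks: "topspace X - U \<in> sets riesz_measure"
      using sets.compl_sets[OF Us] by simp
    have KB: "topspace X - U \<subseteq> B" using U(2) by auto
    have "measure riesz_measure U \<le> measure riesz_measure (topspace X - B) + e"
      using U(3) e Us cB
      by (simp add: emeasure_riesz[symmetric] outer_content_open[OF U(1), symmetric]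
          emeasure_eq_measure ennreal_plus[symmetric] del: ennreal_plus)
    then have "measure riesz_measure B \<le> measure riesz_measure (topspace X - U) + e"
      using finite_measure_compl[OF B] finite_measure_compl[OF Us] by simp
    then have "emeasure riesz_measure B \<le> emeasure riesz_measure (topspace X - U) + ennreal e"
      using e by (simp add: emeasure_eq_measure ennreal_plus[symmetric] del: ennreal_plus)
    also have "\<dots> \<le> (SUP K\<in>{K. compactin X K \<and> K \<subseteq> B}. emeasure riesz_measure K) + ennreal e"
      using K KB by (intro add_right_mono SUP_upper) auto
    finally show "emeasure riesz_measure B \<le> (SUP K\<in>{K. compactin X K \<and> K \<subseteq> B}. emeasure riesz_measure K) + ennreal e" .
  qed
qed

lemma borel_measurable_riesz:
  assumes "continuous_map X euclideanreal f"
  shows "f \<in> borel_measurable riesz_measure"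
proof (rule borel_measurableI)
  fix V :: "real set" assume "open V"
  then have "openin X {x \<in> topspace X. f x \<in> V}"
    using openin_continuous_map_preimage[OF assms] by simp
  moreover have "{x \<in> topspace X. f x \<in> V} = f -` V \<inter> space riesz_measure" by auto
  ultimately show "f -` V \<inter> space riesz_measure \<in> sets riesz_measure"
    by (simp add: sigma_sets.Basic)
qed

lemma integrable_riesz:
  assumes f: "continuous_map X euclideanreal f"
  shows "integrable riesz_measure f"
proof -
  interpret finite_measure riesz_measure by (rule finite_measure_riesz)
  have "compactin euclideanreal (f ` topspace X)"
    using image_compactin[OF _ f] compact_space by (simp add: compact_space_def)
  then have "bounded (f ` topspace X)"
    by (simp add: compact_imp_bounded)
  then obtain B where B: "\<And>x. x \<in> topspace X \<Longrightarrow> \<bar>f x\<bar> \<le> B"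
    by (auto simp: bounded_iff)
  show ?thesis
    by (rule integrable_const_bound[of _ B]) (auto simp: B borel_measurable_riesz[OF f])
qed

text \<open>Cutting \<open>n * f\<close> into \<open>n\<close> layers \<open>g k\<close> with values in \<open>[0, 1]\<close>, each vanishing off \<open>{f > k/n}\<close>, bounds
  \<open>n * \<Lambda> f\<close> by \<open>\<Sum>k<n. \<mu> {f > k/n}\<close>, and the indicators of these sets add up to at most \<open>n * f + 1\<close>.\<close>
lemma functional_le_integral:
  assumes f: "continuous_map X euclideanreal f" and f01: "\<And>x. x \<in> topspace X \<Longrightarrow> 0 \<le> f x \<and> f x \<le> 1"
  shows "\<Lambda> f \<le> (\<integral>x. f x \<partial>riesz_measure)"
proof (rule field_le_epsilon)
  interpret finite_measure riesz_measure by (rule finite_measure_riesz)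
  let ?M = "measure riesz_measure (topspace X)"
  fix e :: real assume e: "0 < e"
  obtain n :: nat where n: "?M / e < real n" using reals_Archimedean2 by blast
  then have n0: "0 < n" using e by (metis divide_nonneg_pos gr0I leD measure_nonneg of_nat_0)
  define U where "U k = {x \<in> topspace X. f x \<in> {real k / real n<..}}" for k :: nat
  define g where "g k = (\<lambda>x. min (max (real n * f x - real k) 0) 1)" for k :: nat
  have oU: "openin X (U k)" for k
    using openin_continuous_map_preimage[OF f, of "{real k / real n<..}"] by (simp add: U_def)
  then have sU: "U k \<in> sets riesz_measure" for k by (simp add: sigma_sets.Basic)
  have UX: "U k \<inter> topspace X = U k" for k by (auto simp: U_def)
  have gc: "continuous_map X euclideanreal (g k)" for k
    unfolding g_def by (intro continuous_map_real_max continuous_map_real_min continuous_map_diff continuous_map_real_mult f) auto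
  have g: "g k \<in> inner_functions (U k)" for k
    using gc[of k] n0 by (auto simp: inner_functions_def g_def U_def field_simps)
  have le: "\<Lambda> (g k) \<le> measure riesz_measure (U k)" for k
    using open_content_upper[OF g[of k]] sU[of k] 
    by (simp add: outer_content_open[OF oU, symmetric] emeasure_riesz[symmetric] emeasure_eq_measure)
  have telescope: "(\<Sum>k<m. min (max (t - real k) 0) 1) = min t (real m)" if "0 \<le> t" for t :: real and m
    by (induction m) (use that in \<open>auto simp: min_def max_def\<close>)
  have sum_g: "(\<Sum>k<n. g k x) = real n * f x" if "x \<in> topspace X" for x
    using telescope[of "real n * f x" n] f01[OF that] n0
    by (simp add: g_def mult_left_le)
  have count: "(\<Sum>k<m. if real k < t then 1 else 0) \<le> t + 1" if "0 \<le> t" for t :: real and m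
  proof (induction m)
    case (Suc m)
    have "(\<Sum>k<m. if real k < t then 1 else 0) \<le> (\<Sum>k<m. 1::real)"
      by (intro sum_mono) auto
    then show ?case using Suc by auto
  qed (use that in auto)
  have sum_U: "(\<Sum>k<n. indicator (U k) x) \<le> real n * f x + 1" if "x \<in> topspace X" for x
  proof -
    have "(\<Sum>k<n. indicator (U k) x) = (\<Sum>k<n. if real k < real n * f x then 1 else (0::real))"
      using that n0 by (intro sum.cong) (auto simp: U_def indicator_def field_simps)
    then show ?thesis using count[of "real n * f x" n] f01[OF that] by simp
  qed
  have "real n * \<Lambda> f = \<Lambda> (\<lambda>x. \<Sum>k<n. g k x)"
    using functional_scale[OF f, of "real n"] sum_g
      functional_cong[of "\<lambda>x. \<Sum>k<n. g k x" "\<lambda>x. real n * f x"]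
    by (simp add: continuous_map_sum gc continuous_map_real_mult f)
  also have "\<dots> = (\<Sum>k<n. \<Lambda> (g k))"
    by (intro functional_sum gc) auto
  also have "\<dots> \<le> (\<Sum>k<n. measure riesz_measure (U k))"
    by (intro sum_mono le)
  also have "\<dots> = (\<integral>x. (\<Sum>k<n. indicator (U k) x) \<partial>riesz_measure)"
    using sU by (subst Bochner_Integration.integral_sum) (auto simp: emeasure_eq_measure UX)
  also have "\<dots> \<le> (\<integral>x. real n * f x + 1 \<partial>riesz_measure)"
    using sU sum_U integrable_riesz[OF f]
    by (intro integral_mono Bochner_Integration.integrable_sum Bochner_Integration.integrable_add) (auto simp: emeasure_eq_measure)
  also have "\<dots> = real n * (\<integral>x. f x \<partial>riesz_measure) + ?M"
    using integrable_riesz[OF f] by simp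
  also have "\<dots> \<le> real n * (\<integral>x. f x \<partial>riesz_measure) + real n * e"
    using n e by (simp add: field_simps)
  finally have "real n * \<Lambda> f \<le> real n * ((\<integral>x. f x \<partial>riesz_measure) + e)"
    by (simp add: algebra_simps)
  then show "\<Lambda> f \<le> (\<integral>x. f x \<partial>riesz_measure) + e"
    using n0 by simp
qed

lemma total_mass: "measure riesz_measure (topspace X) = \<Lambda> (\<lambda>x. 1)"
proof (rule antisym)
  interpret finite_measure riesz_measure by (rule finite_measure_riesz)
  show "\<Lambda> (\<lambda>x. 1) \<le> measure riesz_measure (topspace X)"
    using functional_le_integral[of "\<lambda>x. 1"] by simp
  have "emeasure riesz_measure (topspace X) \<le> ennreal (\<Lambda> (\<lambda>x. 1))"
    using open_content_le by (simp add: emeasure_riesz outer_content_open sigma_sets_top)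
  then show "measure riesz_measure (topspace X) \<le> \<Lambda> (\<lambda>x. 1)"
    using functional_nonneg[of "\<lambda>x. 1"] by (simp add: emeasure_eq_measure)
qed

text \<open>One inequality is enough: applied to \<open>1 - g\<close>, and combined with equality for the constant \<open>1\<close>, the
  bound \<open>functional_le_integral\<close> also gives its converse. The general case follows by an affine
  change that moves the values into \<open>[0, 1]\<close>.\<close>
theorem integral_riesz:
  assumes f: "continuous_map X euclideanreal f"
  shows "(\<integral>x. f x \<partial>riesz_measure) = \<Lambda> f"
proof -
  interpret finite_measure riesz_measure by (rule finite_measure_riesz)
  have eq01: "(\<integral>x. g x \<partial>riesz_measure) = \<Lambda> g"
    if g: "continuous_map X euclideanreal g" and g01: "\<And>x. x \<in> topspace X \<Longrightarrow> 0 \<le> g x \<and> g x \<le> 1" for g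
  proof (rule antisym)
    show "\<Lambda> g \<le> (\<integral>x. g x \<partial>riesz_measure)"
      using functional_le_integral g g01 by blast
    have "\<Lambda> (\<lambda>x. 1 + (-1) * g x) \<le> (\<integral>x. 1 + (-1) * g x \<partial>riesz_measure)"
      by (intro functional_le_integral continuous_map_add continuous_map_real_mult g) (use g01 in auto)
    moreover have "\<Lambda> (\<lambda>x. 1 + (-1) * g x) = \<Lambda> (\<lambda>x. 1) + (-1) * \<Lambda> g"
      by (subst functional_add, simp, intro continuous_map_real_mult g, simp)
        (simp only: functional_scale[OF g])
    ultimately show "(\<integral>x. g x \<partial>riesz_measure) \<le> \<Lambda> g"
      using integrable_riesz[OF g] total_mass by simp
  qed
  have "compactin euclideanreal (f ` topspace X)"
    using image_compactin[OF _ f] compact_space by (simp add: compact_space_def)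
  then have "bounded (f ` topspace X)"
    by (simp add: compact_imp_bounded)
  then obtain B where B: "B > 0" "\<And>x. x \<in> topspace X \<Longrightarrow> \<bar>f x\<bar> \<le> B"
    by (auto simp: bounded_pos)
  define g where "g = (\<lambda>x. 1/2 + (1 / (2 * B)) * f x)"
  have sc: "continuous_map X euclideanreal (\<lambda>x. (1 / (2 * B)) * f x)"
    by (intro continuous_map_real_mult f) auto
  have gc: "continuous_map X euclideanreal g"
    unfolding g_def by (intro continuous_map_add sc) auto
  have g01: "0 \<le> g x \<and> g x \<le> 1" if "x \<in> topspace X" for x
    using B(2)[OF that] B(1) by (auto simp: g_def field_simps abs_le_iff)
  have "\<Lambda> g = \<Lambda> (\<lambda>x. (1/2) * 1) + (1 / (2 * B)) * \<Lambda> f"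
    unfolding g_def by (subst functional_add[OF _ sc]) (use functional_scale[OF f, of "1/(2*B)"] in simp_all)
  then have "\<Lambda> g = (1/2) * \<Lambda> (\<lambda>x. 1) + (1 / (2 * B)) * \<Lambda> f"
    using functional_scale[of "\<lambda>x. 1" "1/2"] by simp
  moreover have "(\<integral>x. g x \<partial>riesz_measure) = (1/2) * measure riesz_measure (topspace X) + (1 / (2 * B)) * (\<integral>x. f x \<partial>riesz_measure)"
    using integrable_riesz[OF f] by (simp add: g_def)
  ultimately show ?thesis
    using eq01[OF gc g01] total_mass B(1) by simp
qed

end

section \<open>Approximate roots in seminormed algebras\<close>

text \<open>The value of a truncated power series at \<open>a\<close>. The seminorm may be neither complete nor separating,
  so no limit of these elements is ever formed.\<close>
definition truncation :: "'a::{real_algebra, comm_ring, comm_monoid_mult} \<Rightarrow> real fps \<Rightarrow> nat \<Rightarrow> 'a" where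
  "truncation a f n = (\<Sum>k\<le>n. fps_nth f k *\<^sub>R a ^ k)"

lemma submult_seminormD:
  assumes "submult_seminorm \<rho>"
  shows "0 \<le> \<rho> x" "\<rho> (r *\<^sub>R x) = \<bar>r\<bar> * \<rho> x" "\<rho> (x + y) \<le> \<rho> x + \<rho> y" "\<rho> (x * y) \<le> \<rho> x * \<rho> y"
  using assms by (auto simp: submult_seminorm_def)

lemma submult_seminorm_zero: "submult_seminorm \<rho> \<Longrightarrow> \<rho> 0 = 0"
  using submult_seminormD(2)[of \<rho> 0 0] by simp

lemma submult_seminorm_sum: "submult_seminorm \<rho> \<Longrightarrow> \<rho> (\<Sum>i\<in>I. f i) \<le> (\<Sum>i\<in>I. \<rho> (f i))"
proof (induction I rule: infinite_finite_induct)
  case (insert i I)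
  then show ?case using submult_seminormD(3)[of \<rho> "f i" "\<Sum>i\<in>I. f i"] by simp
qed (simp_all add: submult_seminorm_zero)

text \<open>The constant is there for \<open>k = 0\<close>: nothing forces \<open>\<rho> 1 \<le> 1\<close>.\<close>
lemma submult_seminorm_power:
  fixes a :: "'a::{real_algebra, comm_ring, comm_monoid_mult}"
  assumes "submult_seminorm \<rho>"
  shows "\<rho> (a ^ k) \<le> max 1 (\<rho> 1) * \<rho> a ^ k"
proof (induction k)
  case (Suc k)
  have "\<rho> (a ^ Suc k) \<le> \<rho> a * \<rho> (a ^ k)"
    using submult_seminormD(4)[OF assms, of a "a ^ k"] by simp
  also have "\<dots> \<le> \<rho> a * (max 1 (\<rho> 1) * \<rho> a ^ k)"
    by (intro mult_left_mono Suc submult_seminormD[OF assms])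
  finally show ?case by (simp add: mult_ac)
qed simp

text \<open>The product of two truncations at \<open>n\<close> differs from the truncated product series by the terms of
  degree above \<open>n\<close>, indexed by a square minus a triangle. Their seminorms are dominated by the same
  difference for the real series of absolute values, which tends to \<open>0\<close> by the theorem on Cauchy
  products.\<close>
lemma truncation_mult_tendsto:
  fixes a :: "'a::{real_algebra, comm_ring, comm_monoid_mult}" and f g :: "real fps"
  assumes \<rho>: "submult_seminorm \<rho>"
    and f: "summable (\<lambda>k. \<bar>fps_nth f k\<bar> * \<rho> a ^ k)" and g: "summable (\<lambda>k. \<bar>fps_nth g k\<bar> * \<rho> a ^ k)"
  shows "summable (\<lambda>k. \<bar>fps_nth (f * g) k\<bar> * \<rho> a ^ k)"
    and "(\<lambda>n. \<rho> (truncation a f n * truncation a g n - truncation a (f * g) n)) \<longlonglongrightarrow> 0"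
proof -
  define D where "D = max 1 (\<rho> 1)"
  define F where "F = (\<lambda>k. \<bar>fps_nth f k\<bar> * \<rho> a ^ k)"
  define G where "G = (\<lambda>k. \<bar>fps_nth g k\<bar> * \<rho> a ^ k)"
  have R: "0 \<le> \<rho> a" using submult_seminormD(1)[OF \<rho>] .
  have FG: "0 \<le> F k" "0 \<le> G k" for k using R by (auto simp: F_def G_def)
  have sF: "summable F" "summable G" using f g by (auto simp: F_def G_def)
  have cauchy: "(\<lambda>k. \<Sum>i\<le>k. F i * G (k - i)) sums ((\<Sum>k. F k) * (\<Sum>k. G k))"
    by (rule Cauchy_product_sums) (use sF FG in auto)
  have FGk: "\<bar>fps_nth (f * g) k\<bar> * \<rho> a ^ k \<le> (\<Sum>i\<le>k. F i * G (k - i))" for k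
  proof -
    have "\<bar>fps_nth (f * g) k\<bar> * \<rho> a ^ k \<le> (\<Sum>i\<le>k. \<bar>fps_nth f i * fps_nth g (k - i)\<bar>) * \<rho> a ^ k"
      unfolding fps_mult_nth atLeast0AtMost using R by (intro mult_right_mono sum_abs) auto
    also have "\<dots> = (\<Sum>i\<le>k. F i * G (k - i))"
      unfolding sum_distrib_right
    proof (intro sum.cong refl)
      fix i assume "i \<in> {..k}"
      then have "\<rho> a ^ k = \<rho> a ^ i * \<rho> a ^ (k - i)" by (simp flip: power_add)
      then show "\<bar>fps_nth f i * fps_nth g (k - i)\<bar> * \<rho> a ^ k = F i * G (k - i)"
        by (simp add: F_def G_def abs_mult)
    qed
    finally show ?thesis .
  qed
  show "summable (\<lambda>k. \<bar>fps_nth (f * g) k\<bar> * \<rho> a ^ k)"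
    by (rule summable_comparison_test'[OF sums_summable[OF cauchy], of 0]) (use FGk R in auto)
  have bound: "\<rho> (truncation a f n * truncation a g n - truncation a (f * g) n)
      \<le> D * ((\<Sum>k\<le>n. F k) * (\<Sum>k\<le>n. G k) - (\<Sum>k\<le>n. \<Sum>i\<le>k. F i * G (k - i)))" for n
  proof -
    define T where "T = (\<lambda>i j. (fps_nth f i * fps_nth g j) *\<^sub>R a ^ (i + j))"
    let ?sq = "{..n} \<times> {..n}" and ?tri = "{(i,j). i + j \<le> n}"
    have tri: "?tri \<subseteq> ?sq" by auto
    have "truncation a f n * truncation a g n = (\<Sum>(i,j)\<in>?sq. T i j)"
      unfolding truncation_def sum_product sum.cartesian_product T_def
      by (simp add: power_add mult.commute)
    moreover have "truncation a (f * g) n = (\<Sum>(i,j)\<in>?tri. T i j)"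
      unfolding truncation_def sum.triangle_reindex_eq fps_mult_nth atLeast0AtMost scaleR_sum_left
      by (intro sum.cong refl) (simp add: T_def)
    ultimately have "truncation a f n * truncation a g n - truncation a (f * g) n
        = (\<Sum>(i,j)\<in>?sq - ?tri. T i j)"
      using sum_diff[OF _ tri, of "\<lambda>(i,j). T i j"] by simp
    also have "\<rho> \<dots> \<le> (\<Sum>(i,j)\<in>?sq - ?tri. \<rho> (T i j))"
      using submult_seminorm_sum[OF \<rho>, of "\<lambda>(i,j). T i j"] by (simp add: case_prod_unfold)
    also have "\<dots> \<le> (\<Sum>(i,j)\<in>?sq - ?tri. D * (F i * G j))"
    proof -
      have "\<rho> (T i j) \<le> D * (F i * G j)" for i j
      proof -
        have "\<rho> (T i j) \<le> \<bar>fps_nth f i * fps_nth g j\<bar> * (D * \<rho> a ^ (i + j))"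
          unfolding T_def D_def submult_seminormD(2)[OF \<rho>]
          by (intro mult_left_mono submult_seminorm_power[OF \<rho>]) auto
        then show ?thesis
          by (simp add: F_def G_def abs_mult power_add mult_ac)
      qed
      then show ?thesis unfolding case_prod_unfold by (intro sum_mono)
    qed
    also have "\<dots> = D * ((\<Sum>(i,j)\<in>?sq. F i * G j) - (\<Sum>(i,j)\<in>?tri. F i * G j))"
      using sum_diff[OF _ tri, of "\<lambda>(i,j). F i * G j"]
      by (simp add: case_prod_unfold sum_distrib_left[symmetric])
    finally show ?thesis
      by (simp add: sum_product sum.cartesian_product sum.triangle_reindex_eq)
  qed
  have "(\<lambda>n. (\<Sum>k\<le>n. F k) * (\<Sum>k\<le>n. G k) - (\<Sum>k\<le>n. \<Sum>i\<le>k. F i * G (k - i)))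
      \<longlonglongrightarrow> (\<Sum>k. F k) * (\<Sum>k. G k) - (\<Sum>k. F k) * (\<Sum>k. G k)"
    by (intro tendsto_diff tendsto_mult summable_LIMSEQ' sF) (use cauchy in \<open>simp add: sums_def_le\<close>)
  then have "(\<lambda>n. D * ((\<Sum>k\<le>n. F k) * (\<Sum>k\<le>n. G k) - (\<Sum>k\<le>n. \<Sum>i\<le>k. F i * G (k - i)))) \<longlonglongrightarrow> 0"
    by (intro tendsto_mult_right_zero) simp
  then show "(\<lambda>n. \<rho> (truncation a f n * truncation a g n - truncation a (f * g) n)) \<longlonglongrightarrow> 0"
    by (rule Lim_null_comparison[rotated])
      (use bound submult_seminormD(1)[OF \<rho>] in \<open>auto intro!: always_eventually\<close>)
qed

lemma truncation_power_tendsto: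
  fixes a :: "'a::{real_algebra, comm_ring, comm_monoid_mult}" and f :: "real fps"
  assumes \<rho>: "submult_seminorm \<rho>" and f: "summable (\<lambda>k. \<bar>fps_nth f k\<bar> * \<rho> a ^ k)"
  shows "summable (\<lambda>k. \<bar>fps_nth (f ^ m) k\<bar> * \<rho> a ^ k) \<and>
    (\<lambda>n. \<rho> (truncation a f n ^ m - truncation a (f ^ m) n)) \<longlonglongrightarrow> 0"
proof (induction m)
  case 0
  have "truncation a 1 n = 1" for n
  proof -
    have "truncation a 1 n = (\<Sum>k\<le>n. if k = 0 then 1 else 0)"
      unfolding truncation_def by (intro sum.cong) auto
    then show ?thesis by simp
  qed
  moreover have "summable (\<lambda>k. \<bar>fps_nth 1 k\<bar> * \<rho> a ^ k)"
    by (rule summable_finite[of "{0}"]) auto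
  ultimately show ?case by (simp add: submult_seminorm_zero[OF \<rho>])
next
  case (Suc m)
  note IH = conjunct1[OF Suc] conjunct2[OF Suc]
  note prod = truncation_mult_tendsto[OF \<rho> f IH(1)]
  define B where "B = max 1 (\<rho> 1) * (\<Sum>k. \<bar>fps_nth f k\<bar> * \<rho> a ^ k)"
  have B: "\<rho> (truncation a f n) \<le> B" for n
  proof -
    have "\<rho> (truncation a f n) \<le> (\<Sum>k\<le>n. \<rho> (fps_nth f k *\<^sub>R a ^ k))"
      unfolding truncation_def by (rule submult_seminorm_sum[OF \<rho>])
    also have "\<dots> \<le> (\<Sum>k\<le>n. \<bar>fps_nth f k\<bar> * (max 1 (\<rho> 1) * \<rho> a ^ k))"
      unfolding submult_seminormD(2)[OF \<rho>]
      by (intro sum_mono mult_left_mono submult_seminorm_power[OF \<rho>]) auto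
    also have "\<dots> = max 1 (\<rho> 1) * (\<Sum>k\<le>n. \<bar>fps_nth f k\<bar> * \<rho> a ^ k)"
      by (simp add: sum_distrib_left mult_ac)
    also have "\<dots> \<le> B"
      unfolding B_def
      by (intro mult_left_mono sum_le_suminf f) (auto simp: submult_seminormD(1)[OF \<rho>])
    finally show ?thesis .
  qed
  have step: "\<rho> (truncation a f n ^ Suc m - truncation a (f ^ Suc m) n)
     \<le> B * \<rho> (truncation a f n ^ m - truncation a (f ^ m) n)
       + \<rho> (truncation a f n * truncation a (f ^ m) n - truncation a (f * f ^ m) n)" for n
  proof -
    have "truncation a f n ^ Suc m - truncation a (f ^ Suc m) n =
        truncation a f n * (truncation a f n ^ m - truncation a (f ^ m) n)
       + (truncation a f n * truncation a (f ^ m) n - truncation a (f * f ^ m) n)"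
      by (simp add: algebra_simps)
    also have "\<rho> \<dots> \<le> \<rho> (truncation a f n) * \<rho> (truncation a f n ^ m - truncation a (f ^ m) n)
       + \<rho> (truncation a f n * truncation a (f ^ m) n - truncation a (f * f ^ m) n)"
      by (rule order_trans[OF submult_seminormD(3)[OF \<rho>] add_right_mono[OF submult_seminormD(4)[OF \<rho>]]])
    also have "\<dots> \<le> B * \<rho> (truncation a f n ^ m - truncation a (f ^ m) n)
       + \<rho> (truncation a f n * truncation a (f ^ m) n - truncation a (f * f ^ m) n)"
      by (intro add_right_mono mult_right_mono B submult_seminormD(1)[OF \<rho>])
    finally show ?thesis .
  qed
  have lim: "(\<lambda>n. B * \<rho> (truncation a f n ^ m - truncation a (f ^ m) n)
       + \<rho> (truncation a f n * truncation a (f ^ m) n - truncation a (f * f ^ m) n)) \<longlonglongrightarrow> 0"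
    using tendsto_add[OF tendsto_mult_right_zero[OF IH(2)] prod(2), of B] by simp
  have "(\<lambda>n. \<rho> (truncation a f n ^ Suc m - truncation a (f ^ Suc m) n)) \<longlonglongrightarrow> 0"
    by (rule Lim_null_comparison[OF _ lim])
      (simp only: real_norm_def abs_of_nonneg[OF submult_seminormD(1)[OF \<rho>]] step eventually_True)
  then show ?case using prod(1) by simp
qed

text \<open>The \<open>m\<close>-th power of the formal binomial series with exponent \<open>1/m\<close> is \<open>1 + X\<close>, and that series
  has radius of convergence at least \<open>1\<close>.\<close>
lemma power_approximates_one_plus:
  fixes a :: "'a::{real_algebra, comm_ring, comm_monoid_mult}"
  assumes \<rho>: "submult_seminorm \<rho>" and a: "\<rho> a < 1" and m: "0 < m"
  obtains p :: "nat \<Rightarrow> 'a" where "(\<lambda>n. \<rho> (p n ^ m - (1 + a))) \<longlonglongrightarrow> 0"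
proof -
  define f :: "real fps" where "f = fps_binomial (1 / of_nat m)"
  have fm: "f ^ m = 1 + fps_X"
    using m by (simp add: f_def fps_binomial_power fps_binomial_1)
  have "ereal (norm (\<rho> a)) < conv_radius (\<lambda>k. fps_nth f k)"
    using a submult_seminormD(1)[OF \<rho>, of a] by (simp add: f_def conv_radius_gchoose)
  then have "summable (\<lambda>k. norm (fps_nth f k * \<rho> a ^ k))"
    by (rule abs_summable_in_conv_radius)
  then have sf: "summable (\<lambda>k. \<bar>fps_nth f k\<bar> * \<rho> a ^ k)"
    using submult_seminormD(1)[OF \<rho>, of a] by (simp add: abs_mult)
  have tr: "truncation a (f ^ m) (Suc n) = 1 + a" for n
  proof -
    have "truncation a (f ^ m) (Suc n) = (\<Sum>k\<in>{0, 1}. fps_nth (1 + fps_X) k *\<^sub>R a ^ k)"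
      unfolding truncation_def fm by (intro sum.mono_neutral_right) (auto simp: fps_X_nth)
    then show ?thesis by simp
  qed
  show thesis
    using LIMSEQ_Suc[OF conjunct2[OF truncation_power_tendsto[OF \<rho> sf, of m]]]
    by (intro that[of "\<lambda>n. truncation a f (Suc n)"]) (simp add: tr)
qed

lemma functional_one_plus_nonneg:
  fixes \<phi> :: "'a::{real_algebra, comm_ring, comm_monoid_mult} \<Rightarrow> real"
  assumes \<rho>: "submult_seminorm \<rho>" and d: "1 \<le> d" and S: "power_module d S"
    and \<phi>: "linear \<phi>" "\<And>x. \<bar>\<phi> x\<bar> \<le> C * \<rho> x" "\<And>s. s \<in> S \<Longrightarrow> 0 \<le> \<phi> s"
    and a: "\<rho> a < 1" and s: "s \<in> S"
  shows "0 \<le> \<phi> ((1 + a) * s)"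
proof -
  obtain p where p: "(\<lambda>n. \<rho> (p n ^ (2 * d) - (1 + a))) \<longlonglongrightarrow> 0"
    using power_approximates_one_plus[OF \<rho> a, of "2 * d"] d by auto
  have C: "0 \<le> C \<or> (\<forall>x. \<rho> x = 0)"
    using \<phi>(2) submult_seminormD(1)[OF \<rho>] by (smt (verit) mult_neg_pos)
  have "norm (\<phi> (p n ^ (2 * d) * s) - \<phi> ((1 + a) * s)) \<le> \<bar>C\<bar> * \<rho> s * \<rho> (p n ^ (2 * d) - (1 + a))" for n
  proof -
    have "\<phi> (p n ^ (2 * d) * s) - \<phi> ((1 + a) * s) = \<phi> ((p n ^ (2 * d) - (1 + a)) * s)"
      using linear_diff[OF \<phi>(1)] by (simp add: algebra_simps)
    also have "norm \<dots> \<le> \<bar>C\<bar> * \<rho> ((p n ^ (2 * d) - (1 + a)) * s)"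
      using \<phi>(2) C by (metis abs_of_nonneg mult_zero_right real_norm_def)
    also have "\<dots> \<le> \<bar>C\<bar> * (\<rho> (p n ^ (2 * d) - (1 + a)) * \<rho> s)"
      by (intro mult_left_mono submult_seminormD[OF \<rho>]) auto
    finally show ?thesis by (simp add: mult_ac)
  qed
  then have "(\<lambda>n. \<phi> (p n ^ (2 * d) * s) - \<phi> ((1 + a) * s)) \<longlonglongrightarrow> 0"
    by (intro Lim_null_comparison[OF _ tendsto_mult_right_zero[OF p]] always_eventually allI)
  then have "(\<lambda>n. \<phi> (p n ^ (2 * d) * s)) \<longlonglongrightarrow> \<phi> ((1 + a) * s)"
    by (simp add: LIM_zero_iff)
  then show ?thesis
    by (rule LIMSEQ_le_const) (use S s \<phi>(3) in \<open>auto simp: power_module_def\<close>)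
qed

text \<open>Automatic sharpening of the constant: for \<open>r > \<rho> a\<close> both \<open>1 + a/r\<close> and \<open>1 - a/r\<close> are limits of
  \<open>2d\<close>-th powers, so \<open>\<bar>\<phi> a\<bar> \<le> r * \<phi> 1\<close>.\<close>
lemma functional_bound:
  fixes \<phi> :: "'a::{real_algebra, comm_ring, comm_monoid_mult} \<Rightarrow> real"
  assumes \<rho>: "submult_seminorm \<rho>" and d: "1 \<le> d" and S: "power_module d S"
    and \<phi>: "linear \<phi>" "\<And>x. \<bar>\<phi> x\<bar> \<le> C * \<rho> x" "\<And>s. s \<in> S \<Longrightarrow> 0 \<le> \<phi> s"
  shows "\<bar>\<phi> a\<bar> \<le> \<phi> 1 * \<rho> a"
proof (rule field_le_epsilon)
  fix e :: real assume e: "0 < e"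
  have one: "1 \<in> S" using S by (simp add: power_module_def)
  have \<phi>1: "0 \<le> \<phi> 1" using \<phi>(3)[OF one] .
  \<comment> \<open>Any \<open>r > \<rho> a\<close> gives \<open>\<bar>\<phi> a\<bar> \<le> \<phi> 1 * r\<close>; this one keeps \<open>\<phi> 1 * (r - \<rho> a)\<close> below \<open>e\<close>.\<close>
  define r where "r = \<rho> a + e / (\<phi> 1 + 1)"
  have r: "\<rho> a < r" "0 < r" using e \<phi>1 submult_seminormD(1)[OF \<rho>, of a] by (auto simp: r_def add_nonneg_pos)
  have "0 \<le> \<phi> ((1 + c *\<^sub>R a) * 1)" if "\<bar>c\<bar> = 1 / r" for c
    using r that by (intro functional_one_plus_nonneg[OF \<rho> d S \<phi> _ one])
      (auto simp: submult_seminormD(2)[OF \<rho>])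
  then have "0 \<le> \<phi> 1 + c * \<phi> a" if "\<bar>c\<bar> = 1 / r" for c
    using that by (simp add: linear_add[OF \<phi>(1)] linear_scale[OF \<phi>(1)])
  from this[of "1/r"] this[of "-1/r"] have "\<bar>\<phi> a\<bar> \<le> \<phi> 1 * r"
    using r by (auto simp: field_simps abs_le_iff)
  also have "\<dots> \<le> \<phi> 1 * \<rho> a + e"
    using \<phi>1 e by (simp add: r_def field_simps)
  finally show "\<bar>\<phi> a\<bar> \<le> \<phi> 1 * \<rho> a + e" .
qed

section \<open>Minimisation at extreme points\<close>

text \<open>Separation of the function space is stated for the abstract topology: the type of functions
  carries a metric when its domain is countable, and the arities that come with that
  instance exclude a Hausdorff instance for arbitrary domains.\<close>
lemma Hausdorff_functions: "Hausdorff_space (euclidean :: ('i \<Rightarrow> real) topology)"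
  unfolding euclidean_product_topology[symmetric]
  by (simp add: Hausdorff_space_product_topology)

lemma compact_imp_closed_fun:
  fixes Q :: "('i \<Rightarrow> real) set"
  assumes "compact Q"
  shows "closed Q"
  using compactin_imp_closedin[OF Hausdorff_functions, of Q] assms by simp

text \<open>Closed extreme subsets in the sense of the Krein--Milman theorem. They are not required to be
  convex.\<close>
definition face_of_functions :: "('i \<Rightarrow> real) set \<Rightarrow> ('i \<Rightarrow> real) set \<Rightarrow> bool" where
  "face_of_functions C Q \<longleftrightarrow> C \<subseteq> Q \<and> C \<noteq> {} \<and> closed C \<and>
     (\<forall>\<phi>\<in>Q. \<forall>\<psi>\<in>Q. \<forall>t. 0 < t \<and> t < 1 \<and> (\<lambda>x. t * \<phi> x + (1 - t) * \<psi> x) \<in> C \<longrightarrow> \<phi> \<in> C \<and> \<psi> \<in> C)"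

lemma face_of_functionsI:
  assumes "C \<subseteq> Q" "C \<noteq> {}" "closed C"
    and "\<And>\<phi> \<psi> t. \<phi> \<in> Q \<Longrightarrow> \<psi> \<in> Q \<Longrightarrow> 0 < t \<Longrightarrow> t < 1 \<Longrightarrow>
      (\<lambda>x. t * \<phi> x + (1 - t) * \<psi> x) \<in> C \<Longrightarrow> \<phi> \<in> C \<and> \<psi> \<in> C"
  shows "face_of_functions C Q"
  unfolding face_of_functions_def
proof (rule conjI[OF assms(1) conjI[OF assms(2) conjI[OF assms(3)]]], intro ballI allI impI, elim conjE)
qed (rule assms(4))

lemma face_of_functionsD:
  assumes "face_of_functions C Q" "\<phi> \<in> Q" "\<psi> \<in> Q" "0 < t" "t < 1"
    "(\<lambda>x. t * \<phi> x + (1 - t) * \<psi> x) \<in> C"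
  shows "\<phi> \<in> C" "\<psi> \<in> C"
  using assms unfolding face_of_functions_def by blast+

lemma face_minimum:
  assumes Q: "compact Q" and C: "face_of_functions C Q"
  obtains D where "face_of_functions D Q" "D \<subseteq> C" "\<And>\<phi> \<psi>. \<phi> \<in> D \<Longrightarrow> \<psi> \<in> C \<Longrightarrow> \<phi> x \<le> \<psi> x"
proof -
  have CQ: "C \<subseteq> Q" "C \<noteq> {}" "closed C" using C by (auto simp: face_of_functions_def)
  have "compact C"
    using compact_Int_closed[OF Q CQ(3)] CQ(1) by (simp add: Int_absorb1)
  moreover have "continuous_on C (\<lambda>\<phi>. \<phi> x)"
    by (rule continuous_on_subset[OF continuous_on_product_coordinates subset_UNIV])
  ultimately obtain \<phi>0 where \<phi>0: "\<phi>0 \<in> C" "\<And>\<psi>. \<psi> \<in> C \<Longrightarrow> \<phi>0 x \<le> \<psi> x"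
    using continuous_attains_inf[of C "\<lambda>\<phi>. \<phi> x"] CQ(2) by auto
  define D where "D = {\<phi> \<in> C. \<phi> x = \<phi>0 x}"
  have clD: "closed D"
    unfolding D_def using CQ(3)
    by (intro closed_Collect_conj closed_Collect_eq continuous_intros) auto
  have *: "\<phi> \<in> D \<and> \<psi> \<in> D"
    if *: "\<phi> \<in> Q" "\<psi> \<in> Q" "0 < t" "t < 1" "(\<lambda>x. t * \<phi> x + (1 - t) * \<psi> x) \<in> D" for \<phi> \<psi> t
  proof -
    have in_C: "\<phi> \<in> C" "\<psi> \<in> C"
      using face_of_functionsD[OF C *(1-4)] *(5) by (auto simp: D_def)
    have ge: "0 \<le> \<phi> x - \<phi>0 x" "0 \<le> \<psi> x - \<phi>0 x" using in_C \<phi>0(2) by auto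
    have "t * (\<phi> x - \<phi>0 x) + (1 - t) * (\<psi> x - \<phi>0 x) = 0"
      using *(5) by (simp add: D_def algebra_simps)
    then have "t * (\<phi> x - \<phi>0 x) = 0 \<and> (1 - t) * (\<psi> x - \<phi>0 x) = 0"
      using ge *(3,4) by (subst (asm) add_nonneg_eq_0_iff) auto
    then show ?thesis using in_C *(3,4) by (auto simp: D_def)
  qed
  have "face_of_functions D Q"
    using CQ(1) \<phi>0(1) by (intro face_of_functionsI clD *) (auto simp: D_def)
  then show thesis
    by (rule that) (auto simp: D_def \<phi>0)
qed

lemma Inter_finite_chain:
  assumes "finite \<C>" "\<C> \<noteq> {}" "\<And>C D. C \<in> \<C> \<Longrightarrow> D \<in> \<C> \<Longrightarrow> C \<subseteq> D \<or> D \<subseteq> C"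
  shows "\<Inter>\<C> \<in> \<C>"
  using assms
proof (induction \<C> rule: finite_ne_induct)
  case (insert C \<C>)
  then have "\<Inter>\<C> \<in> \<C>" by auto
  then show ?case
    using insert.prems[of C "\<Inter>\<C>"] by (auto simp: Int_absorb1 Int_absorb2)
qed auto

text \<open>The Krein--Milman argument: by Zorn's lemma and compactness, the face of minimisers of evaluation
  at \<open>x\<close> contains a minimal face. Minimising a further evaluation on it cuts out a subface, so all
  evaluations are constant on the minimal face, which is thus a single point.\<close>
lemma exists_minimizing_extreme_point:
  fixes Q :: "('i \<Rightarrow> real) set"
  assumes Q: "compact Q" "Q \<noteq> {}"
  obtains \<phi> where "\<phi> \<in> Q" "\<And>\<psi>. \<psi> \<in> Q \<Longrightarrow> \<phi> x \<le> \<psi> x"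
    "\<And>\<phi>1 \<phi>2 t. \<phi>1 \<in> Q \<Longrightarrow> \<phi>2 \<in> Q \<Longrightarrow> 0 < t \<Longrightarrow> t < 1 \<Longrightarrow>
       \<phi> = (\<lambda>x. t * \<phi>1 x + (1 - t) * \<phi>2 x) \<Longrightarrow> \<phi>1 = \<phi>"
proof -
  have QQ: "face_of_functions Q Q"
    using Q compact_imp_closed_fun by (auto simp: face_of_functions_def)
  obtain D where D: "face_of_functions D Q" "D \<subseteq> Q" "\<And>\<phi> \<psi>. \<phi> \<in> D \<Longrightarrow> \<psi> \<in> Q \<Longrightarrow> \<phi> x \<le> \<psi> x"
    by (rule face_minimum[OF Q(1) QQ, of x]) (rule that)
  define \<A> where "\<A> = {C. face_of_functions C Q \<and> C \<subseteq> D}"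
  have "\<exists>M\<in>\<A>. \<forall>C\<in>\<A>. C \<subseteq> M \<longrightarrow> C = M"
  proof (rule predicate_Zorn[of _ "\<lambda>C E. E \<subseteq> C"])
    show "partial_order_on \<A> (relation_of (\<lambda>C E. E \<subseteq> C) \<A>)"
      by (rule partial_order_on_relation_ofI) auto
    fix \<C> assume chain: "\<C> \<in> Chains (relation_of (\<lambda>C E. E \<subseteq> C) \<A>)"
    have sub: "\<C> \<subseteq> \<A>" and lin: "\<And>C E. C \<in> \<C> \<Longrightarrow> E \<in> \<C> \<Longrightarrow> C \<subseteq> E \<or> E \<subseteq> C"
      using chain by (auto simp: Chains_def relation_of_def)
    have face: "face_of_functions C Q" if "C \<in> \<C>" for C using sub that by (auto simp: \<A>_def)
    show "\<exists>u\<in>\<A>. \<forall>C\<in>\<C>. u \<subseteq> C"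
    proof (cases "\<C> = {}")
      case True
      then show ?thesis using D(1) by (auto simp: \<A>_def)
    next
      case False
      have ne: "Q \<inter> \<Inter>\<C> \<noteq> {}"
      proof (rule compact_imp_fip[OF Q(1)])
        show "closed C" if "C \<in> \<C>" for C using face[OF that] by (simp add: face_of_functions_def)
        show "Q \<inter> \<Inter>\<F> \<noteq> {}" if F: "finite \<F>" "\<F> \<subseteq> \<C>" for \<F>
        proof (cases "\<F> = {}")
          case False
          then have "\<Inter>\<F> \<in> \<C>" using Inter_finite_chain[of \<F>] F lin by blast
          then show ?thesis using face[of "\<Inter>\<F>"] unfolding face_of_functions_def by blast
        qed (simp add: Q)
      qed
      have cl: "closed (\<Inter>\<C>)"
        using face by (auto simp: face_of_functions_def intro!: closed_Inter)
      have sb: "\<Inter>\<C> \<subseteq> D" "\<Inter>\<C> \<subseteq> Q"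
        using False sub D(2) by (auto simp: \<A>_def)
      have mid: "\<phi> \<in> \<Inter>\<C> \<and> \<psi> \<in> \<Inter>\<C>"
        if "\<phi> \<in> Q" "\<psi> \<in> Q" "0 < t" "t < 1" "(\<lambda>x. t * \<phi> x + (1 - t) * \<psi> x) \<in> \<Inter>\<C>" for \<phi> \<psi> t
        using face_of_functionsD[OF face that(1-4)] that(5) by blast
      have "\<Inter>\<C> \<noteq> {}" using ne by blast
      then have "face_of_functions (\<Inter>\<C>) Q"
        by (rule face_of_functionsI[OF sb(2) _ cl mid])
      then have "\<Inter>\<C> \<in> \<A>"
        using sb by (simp add: \<A>_def)
      then show ?thesis by blast
    qed
  qed
  then obtain M where MA: "M \<in> \<A>" and minA: "\<And>C. C \<in> \<A> \<Longrightarrow> C \<subseteq> M \<Longrightarrow> C = M"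
    by auto
  then have M: "face_of_functions M Q" "M \<subseteq> D" by (auto simp: \<A>_def)
  have min: "C = M" if "face_of_functions C Q" "C \<subseteq> M" for C
    using minA[of C] that M(2) by (auto simp: \<A>_def)
  have single: "\<phi> = \<psi>" if "\<phi> \<in> M" "\<psi> \<in> M" for \<phi> \<psi>
  proof
    fix y
    obtain C where C: "face_of_functions C Q" "C \<subseteq> M" "\<And>\<phi> \<psi>. \<phi> \<in> C \<Longrightarrow> \<psi> \<in> M \<Longrightarrow> \<phi> y \<le> \<psi> y"
      by (rule face_minimum[OF Q(1) M(1), of y]) (rule that)
    then have "C = M" by (intro min)
    then show "\<phi> y = \<psi> y" using C(3) that by (intro antisym) auto
  qed
  obtain \<phi> where \<phi>: "\<phi> \<in> M" using M(1) by (auto simp: face_of_functions_def)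
  show thesis
  proof
    show "\<phi> \<in> Q" using \<phi> M D(2) by auto
    show "\<phi> x \<le> \<psi> x" if "\<psi> \<in> Q" for \<psi> using D(3) \<phi> M(2) that by auto
    show "\<phi>1 = \<phi>" if "\<phi>1 \<in> Q" "\<phi>2 \<in> Q" "0 < t" "t < 1" "\<phi> = (\<lambda>x. t * \<phi>1 x + (1 - t) * \<phi>2 x)" for \<phi>1 \<phi>2 t
      using face_of_functionsD(1)[OF M(1) that(1-4)] \<phi> that(5) single by auto
  qed
qed

section \<open>Positivity on characters implies positivity\<close>

text \<open>When \<open>S\<close> is a module over the sums of \<open>2d\<close>-th powers, the last condition expresses just continuity
  with respect to \<open>\<rho>\<close>, by \<open>functional_bound\<close>; written with this constant it makes the set compact.\<close>
definition positive_states ::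
  "('a::{real_algebra, comm_ring, comm_monoid_mult} \<Rightarrow> real) \<Rightarrow> 'a set \<Rightarrow> ('a \<Rightarrow> real) set" where
  "positive_states \<rho> S =
     {\<phi>. linear \<phi> \<and> \<phi> 1 = 1 \<and> (\<forall>s\<in>S. 0 \<le> \<phi> s) \<and> (\<forall>a. \<bar>\<phi> a\<bar> \<le> \<rho> a)}"

definition bounded_characters ::
  "('a::{real_algebra, comm_ring, comm_monoid_mult} \<Rightarrow> real) \<Rightarrow> ('a \<Rightarrow> real) set" where
  "bounded_characters \<rho> = {\<alpha> \<in> characters. \<forall>a. \<bar>\<alpha> a\<bar> \<le> \<rho> a}"

lemma compact_bounded_functions: "compact {\<phi>. \<forall>a. \<bar>\<phi> a\<bar> \<le> (\<rho> a :: real)}"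
proof -
  have "compactin (powertop_real UNIV) (PiE UNIV (\<lambda>a. {- \<rho> a..\<rho> a}))"
    by (simp add: compactin_PiE)
  moreover have "PiE UNIV (\<lambda>a. {- \<rho> a..\<rho> a}) = {\<phi>. \<forall>a. \<bar>\<phi> a\<bar> \<le> \<rho> a}"
    by (auto simp: PiE_def Pi_def abs_le_iff minus_le_iff)
  ultimately show ?thesis by (simp add: euclidean_product_topology)
qed

lemma closed_linear_functions: "closed {\<phi> :: 'a::real_vector \<Rightarrow> real. linear \<phi>}"
proof -
  have "{\<phi> :: 'a \<Rightarrow> real. linear \<phi>} =
    {\<phi>. (\<forall>x y. \<phi> (x + y) = \<phi> x + \<phi> y) \<and> (\<forall>r x. \<phi> (r *\<^sub>R x) = r * \<phi> x)}"
    by (auto simp: linear_iff)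
  then show ?thesis
    by (simp only:) (intro closed_Collect_conj closed_Collect_all closed_Collect_eq
        continuous_intros continuous_on_product_coordinates)
qed

lemma closed_characters:
  "closed (characters :: ('a::{real_algebra, comm_ring, comm_monoid_mult} \<Rightarrow> real) set)"
proof -
  have eq: "(characters :: ('a \<Rightarrow> real) set) = {\<alpha> :: 'a \<Rightarrow> real. linear \<alpha>} \<inter> {\<alpha>. (\<forall>x y. \<alpha> (x * y) = \<alpha> x * \<alpha> y) \<and> \<alpha> 1 = 1}"
    by (auto simp: characters_def)
  show ?thesis
    unfolding eq by (intro closed_Int closed_linear_functions closed_Collect_conj closed_Collect_all closed_Collect_eq
        continuous_intros continuous_on_product_coordinates)
qed

lemma compact_positive_states: "compact (positive_states \<rho> S)"
proof -
  have eq: "positive_states \<rho> S = {\<phi>. \<forall>a. \<bar>\<phi> a\<bar> \<le> \<rho> a} \<inter> ({\<phi>. linear \<phi>} \<inter> {\<phi>. \<phi> 1 = 1 \<and> (\<forall>s. s \<in> S \<longrightarrow> 0 \<le> \<phi> s)})"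
    by (auto simp: positive_states_def)
  show ?thesis
    unfolding eq
    by (intro compact_Int_closed compact_bounded_functions closed_Int closed_linear_functions
        closed_Collect_conj closed_Collect_all closed_Collect_imp closed_Collect_eq closed_Collect_le continuous_intros) auto
qed

lemma compact_bounded_characters: "compact (bounded_characters \<rho>)"
proof -
  have eq: "bounded_characters \<rho> = {\<phi>. \<forall>a. \<bar>\<phi> a\<bar> \<le> \<rho> a} \<inter> characters"
    by (auto simp: bounded_characters_def)
  show ?thesis
    unfolding eq by (intro compact_Int_closed compact_bounded_functions closed_characters)
qed

lemma closed_nonneg_characters: "closed (nonneg_characters S)"
proof -
  have eq: "nonneg_characters S = characters \<inter> {\<phi>. (\<forall>s. s \<in> S \<longrightarrow> 0 \<le> \<phi> s)}"
    by (auto simp: nonneg_characters_def)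
  show ?thesis
    unfolding eq
    by (intro closed_Int closed_characters closed_Collect_all closed_Collect_imp closed_Collect_le continuous_intros) auto
qed

text \<open>With \<open>c\<close> so small that \<open>\<rho> (c a) < 1\<close>, the functionals \<open>x \<mapsto> \<phi> ((1 + c a) * x)\<close> and
  \<open>x \<mapsto> \<phi> ((1 - c a) * x)\<close> are nonnegative on \<open>S\<close> and, once normalised, have \<open>\<phi>\<close> as a convex
  combination. Extremality gives \<open>\<phi> ((1 + c a) * x) = \<phi> (1 + c a) * \<phi> x\<close>, which is the claim up to
  linearity.\<close>
lemma extreme_state_multiplicative:
  fixes \<phi> :: "'a::{real_algebra, comm_ring, comm_monoid_mult} \<Rightarrow> real"
  assumes \<rho>: "submult_seminorm \<rho>" and d: "1 \<le> d" and S: "power_module d S"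
    and \<phi>: "\<phi> \<in> positive_states \<rho> S"
    and extreme: "\<And>\<phi>1 \<phi>2 t. \<phi>1 \<in> positive_states \<rho> S \<Longrightarrow> \<phi>2 \<in> positive_states \<rho> S \<Longrightarrow> 0 < t \<Longrightarrow> t < 1 \<Longrightarrow>
       \<phi> = (\<lambda>x. t * \<phi>1 x + (1 - t) * \<phi>2 x) \<Longrightarrow> \<phi>1 = \<phi>"
  shows "\<phi> (a * x) = \<phi> a * \<phi> x"
proof -
  have lin: "linear \<phi>" and one: "\<phi> 1 = 1" and pos: "\<And>s. s \<in> S \<Longrightarrow> 0 \<le> \<phi> s"
    and bd: "\<And>a. \<bar>\<phi> a\<bar> \<le> 1 * \<rho> a"
    using \<phi> by (auto simp: positive_states_def)
  define c where "c = 1 / (\<rho> a + 1)"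
  have c: "0 < c" "c * \<rho> a < 1"
    using submult_seminormD(1)[OF \<rho>, of a] by (auto simp: c_def field_simps)
  define \<psi> where "\<psi> u = (\<lambda>x. \<phi> ((1 + u *\<^sub>R a) * x) / \<phi> (1 + u *\<^sub>R a))" for u
  have \<phi>t: "\<phi> (1 + u *\<^sub>R a) = 1 + u * \<phi> a" for u
    by (simp add: linear_add[OF lin] linear_scale[OF lin] one)
  have small: "\<bar>u * \<phi> a\<bar> < 1" if "\<bar>u\<bar> = c" for u
  proof -
    have "\<bar>u * \<phi> a\<bar> \<le> c * \<rho> a" using bd[of a] that c(1) by (simp add: abs_mult mult_left_mono)
    then show ?thesis using c(2) by simp
  qed
  have state: "\<psi> u \<in> positive_states \<rho> S" if u: "\<bar>u\<bar> = c" for u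
  proof -
    define m where "m = \<phi> (1 + u *\<^sub>R a)"
    have m: "0 < m" using small[OF u] by (auto simp: m_def \<phi>t)
    have lin': "linear (\<psi> u)"
      by (rule linearI)
        (simp_all add: \<psi>_def distrib_left add_divide_distrib linear_add[OF lin] linear_scale[OF lin])
    have pos': "0 \<le> \<psi> u s" if "s \<in> S" for s
      using functional_one_plus_nonneg[OF \<rho> d S lin bd pos _ that, of "u *\<^sub>R a"] m u c(2)
      by (simp add: \<psi>_def m_def submult_seminormD(2)[OF \<rho>])
    have bd': "\<bar>\<psi> u x\<bar> \<le> (\<rho> (1 + u *\<^sub>R a) / m) * \<rho> x" for x
    proof -
      have "\<bar>\<phi> ((1 + u *\<^sub>R a) * x)\<bar> \<le> \<rho> (1 + u *\<^sub>R a) * \<rho> x"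
        using bd submult_seminormD(4)[OF \<rho>] by (metis mult_1 order_trans)
      moreover have "\<bar>\<psi> u x\<bar> = \<bar>\<phi> ((1 + u *\<^sub>R a) * x)\<bar> / m"
        using m by (simp add: \<psi>_def flip: m_def)
      ultimately show ?thesis using m by (simp add: divide_right_mono)
    qed
    have "\<psi> u 1 = 1" using m by (simp add: \<psi>_def m_def)
    then show ?thesis
      using functional_bound[OF \<rho> d S lin' bd' pos'] lin' pos' by (simp add: positive_states_def)
  qed
  define t where "t = \<phi> (1 + c *\<^sub>R a) / 2"
  have 1: "1 - t = \<phi> (1 + (- c) *\<^sub>R a) / 2" unfolding \<phi>t t_def by (simp add: field_simps)
  have nz: "0 < 1 + c * \<phi> a" "0 < 1 + (- c) * \<phi> a"
    using small[of c] c(1) by (auto simp: abs_less_iff)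
  have t: "0 < t" "t < 1" using nz 1 unfolding \<phi>t t_def by auto
  have "\<phi> = (\<lambda>x. t * \<psi> c x + (1 - t) * \<psi> (- c) x)"
  proof
    fix x
    have "t * \<psi> c x = \<phi> ((1 + c *\<^sub>R a) * x) / 2" "(1 - t) * \<psi> (- c) x = \<phi> ((1 + (- c) *\<^sub>R a) * x) / 2"
      using nz unfolding 1 unfolding t_def \<psi>_def \<phi>t[symmetric] by simp_all
    then have "t * \<psi> c x + (1 - t) * \<psi> (- c) x = \<phi> ((1 + c *\<^sub>R a) * x + (1 + (- c) *\<^sub>R a) * x) / 2"
      by (simp add: linear_add[OF lin] add_divide_distrib)
    also have "(1 + c *\<^sub>R a) * x + (1 + (- c) *\<^sub>R a) * x = 2 *\<^sub>R x"
      by (simp add: distrib_right left_diff_distrib scaleR_2)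
    finally show "\<phi> x = t * \<psi> c x + (1 - t) * \<psi> (- c) x"
      by (simp add: linear_scale[OF lin])
  qed
  then have "\<psi> c = \<phi>"
    using state c(1) t by (intro extreme[of _ "\<psi> (- c)" t]) auto
  then have "\<phi> ((1 + c *\<^sub>R a) * x) = (1 + c * \<phi> a) * \<phi> x"
    using nz(1) by (auto simp: \<psi>_def \<phi>t field_simps fun_eq_iff)
  then show ?thesis
    using c(1) by (simp add: distrib_right linear_add[OF lin] linear_scale[OF lin] mult.assoc)
qed

text \<open>If \<open>L 1 \<noteq> 0\<close>, the normalisation of \<open>L\<close> is a state, and the minimum over all states of evaluation
  at \<open>a\<close> is attained at an extreme one, which is one of the characters in question.
  If \<open>L 1 = 0\<close> then \<open>L = 0\<close> by \<open>functional_bound\<close>.\<close>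
theorem functional_nonneg_of_nonneg_on_characters:
  fixes L :: "'a::{real_algebra, comm_ring, comm_monoid_mult} \<Rightarrow> real"
  assumes \<rho>: "submult_seminorm \<rho>" and d: "1 \<le> d" and S: "power_module d S"
    and L: "linear L" "\<And>x. \<bar>L x\<bar> \<le> C * \<rho> x" "\<And>s. s \<in> S \<Longrightarrow> 0 \<le> L s"
    and a: "\<And>\<alpha>. \<alpha> \<in> nonneg_characters S \<inter> bounded_characters \<rho> \<Longrightarrow> 0 \<le> \<alpha> a"
  shows "0 \<le> L a"
proof (cases "L 1 = 0")
  case True
  then show ?thesis using functional_bound[OF \<rho> d S L, of a] by simp
next
  case False
  have L1: "0 < L 1" using False L(3)[of 1] S by (simp add: power_module_def)
  define \<psi> where "\<psi> = (\<lambda>x. L x / L 1)"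
  have "linear \<psi>"
    by (rule linearI) (simp_all add: \<psi>_def add_divide_distrib linear_add[OF L(1)] linear_scale[OF L(1)])
  then have \<psi>: "\<psi> \<in> positive_states \<rho> S"
    using functional_bound[OF \<rho> d S L] L(3) L1
    by (auto simp: positive_states_def \<psi>_def divide_le_eq mult.commute)
  obtain \<phi> where \<phi>: "\<phi> \<in> positive_states \<rho> S" "\<And>\<psi>. \<psi> \<in> positive_states \<rho> S \<Longrightarrow> \<phi> a \<le> \<psi> a"
    "\<And>\<phi>1 \<phi>2 t. \<phi>1 \<in> positive_states \<rho> S \<Longrightarrow> \<phi>2 \<in> positive_states \<rho> S \<Longrightarrow> 0 < t \<Longrightarrow> t < 1 \<Longrightarrow>
       \<phi> = (\<lambda>x. t * \<phi>1 x + (1 - t) * \<phi>2 x) \<Longrightarrow> \<phi>1 = \<phi>"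
    by (rule exists_minimizing_extreme_point[OF compact_positive_states, of \<rho> S a]) (use \<psi> in auto)
  have "\<phi> \<in> nonneg_characters S \<inter> bounded_characters \<rho>"
    using \<phi>(1) extreme_state_multiplicative[OF \<rho> d S \<phi>(1) \<phi>(3)]
    by (auto simp: nonneg_characters_def bounded_characters_def characters_def positive_states_def)
  then have "0 \<le> \<psi> a" using a[of \<phi>] \<phi>(2)[OF \<psi>] by linarith
  then show ?thesis using L1 by (simp add: \<psi>_def zero_le_divide_iff)
qed

section \<open>Topologies generated by seminorms\<close>

text \<open>Closure of the family under maxima is what lets one ball replace a finite intersection of balls.\<close>
lemma seminorm_topology_openD:
  assumes F: "saturated_family F" and U: "openin (seminorm_topology F) U" and x: "x \<in> U"
  shows "\<exists>\<rho>\<in>F. \<exists>r>0. {y. \<rho> (y - x) < r} \<subseteq> U"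
proof -
  have sn: "submult_seminorm \<rho>" if "\<rho> \<in> F" for \<rho> using F that by (simp add: saturated_family_def)
  have "generate_topology_on {{x. \<rho> (x - a) < r} | \<rho> a r. \<rho> \<in> F \<and> 0 < r} U"
    using U unfolding seminorm_topology_def by (rule openin_topology_generated_by)
  then show ?thesis using x
  proof (induction arbitrary: x rule: generate_topology_on.induct)
    case (Int U V)
    obtain \<rho>1 r1 where 1: "\<rho>1 \<in> F" "0 < r1" "{y. \<rho>1 (y - x) < r1} \<subseteq> U"
      using Int.IH(1)[of x] Int.prems by auto
    obtain \<rho>2 r2 where 2: "\<rho>2 \<in> F" "0 < r2" "{y. \<rho>2 (y - x) < r2} \<subseteq> V"
      using Int.IH(2)[of x] Int.prems by auto
    have "(\<lambda>x. max (\<rho>1 x) (\<rho>2 x)) \<in> F" using F 1(1) 2(1) by (simp add: saturated_family_def)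
    moreover have "{y. max (\<rho>1 (y - x)) (\<rho>2 (y - x)) < min r1 r2} \<subseteq> U \<inter> V" using 1(3) 2(3) by auto
    moreover have "0 < min r1 r2" using 1(2) 2(2) by simp
    ultimately show ?case by (intro bexI[of _ "\<lambda>x. max (\<rho>1 x) (\<rho>2 x)"] exI[of _ "min r1 r2"] conjI)
  next
    case (UN K)
    then obtain k where k: "k \<in> K" "x \<in> k" by blast
    then obtain \<rho> r where \<rho>: "\<rho> \<in> F" "0 < r" "{y. \<rho> (y - x) < r} \<subseteq> k"
      using UN.IH[of k x] by auto
    have "{y. \<rho> (y - x) < r} \<subseteq> \<Union>K" using \<rho>(3) k(1) by (rule order_trans[OF _ Union_upper])
    with \<rho>(1,2) show ?case by (intro bexI[of _ \<rho>] exI[of _ r] conjI)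
  next
    case (Basis U)
    then obtain \<rho> a r where U: "U = {x. \<rho> (x - a) < r}" "\<rho> \<in> F" "0 < r" by blast
    have "{y. \<rho> (y - x) < r - \<rho> (x - a)} \<subseteq> U"
    proof
      fix y assume y: "y \<in> {y. \<rho> (y - x) < r - \<rho> (x - a)}"
      have "\<rho> (y - a) \<le> \<rho> (y - x) + \<rho> (x - a)"
        using submult_seminormD(3)[OF sn[OF U(2)], of "y - x" "x - a"] by simp
      with y show "y \<in> U" by (simp add: U(1))
    qed
    moreover have "0 < r - \<rho> (x - a)" using Basis.prems by (simp add: U(1))
    ultimately show ?case using U(2) by (intro bexI[of _ \<rho>] exI[of _ "r - \<rho> (x - a)"] conjI)
  qed simp
qed

lemma topspace_seminorm_topology:
  assumes "saturated_family F"
  shows "topspace (seminorm_topology F) = UNIV"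
proof -
  obtain \<rho> where \<rho>: "\<rho> \<in> F" "submult_seminorm \<rho>" using assms by (auto simp: saturated_family_def)
  have "x \<in> \<Union>{{x. \<rho> (x - a) < r} | \<rho> a r. \<rho> \<in> F \<and> 0 < r}" for x
  proof (rule UnionI)
    show "{y. \<rho> (y - x) < 1} \<in> {{x. \<rho> (x - a) < r} | \<rho> a r. \<rho> \<in> F \<and> 0 < r}"
      using \<rho>(1) zero_less_one by blast
  qed (simp add: submult_seminorm_zero[OF \<rho>(2)])
  then show ?thesis by (auto simp: seminorm_topology_def)
qed

lemma continuous_linear_functional_bounded:
  fixes L :: "'a::real_algebra \<Rightarrow> real"
  assumes F: "saturated_family F" and L: "linear L" "continuous_map (seminorm_topology F) euclideanreal L"
  obtains \<rho> C where "\<rho> \<in> F" "0 < C" "\<And>x. \<bar>L x\<bar> \<le> C * \<rho> x"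
proof -
  have "openin (seminorm_topology F) {x \<in> topspace (seminorm_topology F). L x \<in> {-1<..<1}}"
    by (rule openin_continuous_map_preimage[OF L(2)]) simp
  then obtain \<rho> r where \<rho>: "\<rho> \<in> F" "0 < r" "{y. \<rho> (y - 0) < r} \<subseteq> {x. L x \<in> {-1<..<1}}"
    using seminorm_topology_openD[OF F, of _ 0]
    by (force simp: topspace_seminorm_topology[OF F] linear_0[OF L(1)])
  have sn: "submult_seminorm \<rho>" using F \<rho>(1) by (simp add: saturated_family_def)
  have "\<bar>L x\<bar> \<le> (1 / r) * \<rho> x" for x
  proof (rule field_le_epsilon)
    fix e :: real assume e: "0 < e"
    define m where "m = \<rho> x + r * e"
    have m: "0 < m" using submult_seminormD(1)[OF sn, of x] e \<rho>(2) by (simp add: m_def add_nonneg_pos)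
    have "\<rho> ((r / m) *\<^sub>R x - 0) < r"
      using m e \<rho>(2) by (simp add: submult_seminormD(2)[OF sn] field_simps) (simp add: m_def)
    then have "L ((r / m) *\<^sub>R x) \<in> {-1<..<1}" using \<rho>(3) by blast
    then have "\<bar>(r / m) * L x\<bar> < 1"
      unfolding linear_scale[OF L(1)] real_scaleR_def greaterThanLessThan_iff by linarith
    then have "(r / m) * \<bar>L x\<bar> < 1" using m \<rho>(2) by (simp only: abs_mult abs_of_pos[OF divide_pos_pos])
    then have "\<bar>L x\<bar> < m / r" using m \<rho>(2) by (simp add: field_simps)
    also have "\<dots> = (1 / r) * \<rho> x + e" using \<rho>(2) by (simp add: m_def field_simps)
    finally show "\<bar>L x\<bar> \<le> (1 / r) * \<rho> x + e" by simp
  qed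
  with \<rho>(1,2) show thesis by (intro that[of \<rho> "1 / r"]) auto
qed

text \<open>For a character \<open>\<alpha>\<close> the set \<open>{x. 0 \<le> \<alpha> x}\<close> is itself a module over the sums of squares, so
  \<open>functional_bound\<close> applies to \<open>\<alpha>\<close> and replaces the continuity constant by \<open>\<alpha> 1 = 1\<close>.\<close>
lemma gelfand_spectrum_eq:
  assumes \<rho>: "submult_seminorm \<rho>"
  shows "gelfand_spectrum \<rho> = bounded_characters \<rho>"
proof (intro equalityI subsetI)
  have F: "saturated_family {\<rho>}" using \<rho> by (simp add: saturated_family_def)
  fix \<alpha> :: "'a \<Rightarrow> real"
  {
    assume "\<alpha> \<in> gelfand_spectrum \<rho>"
    then have \<alpha>: "\<alpha> \<in> characters" and cont: "continuous_map (seminorm_topology {\<rho>}) euclideanreal \<alpha>"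
      by (auto simp: gelfand_spectrum_def)
    then have lin: "linear \<alpha>" and mult: "\<And>x y. \<alpha> (x * y) = \<alpha> x * \<alpha> y" and one: "\<alpha> 1 = 1"
      by (auto simp: characters_def)
    obtain C where C: "\<And>x. \<bar>\<alpha> x\<bar> \<le> C * \<rho> x"
      using continuous_linear_functional_bounded[OF F lin cont] by blast
    have "power_module 1 {x. 0 \<le> \<alpha> x}"
      by (simp add: power_module_def one mult linear_add[OF lin] power2_eq_square)
    then have "\<bar>\<alpha> a\<bar> \<le> \<alpha> 1 * \<rho> a" for a
      by (rule functional_bound[OF \<rho> order_refl _ lin C]) simp
    with \<alpha> show "\<alpha> \<in> bounded_characters \<rho>" by (simp add: bounded_characters_def one)
  next
    assume "\<alpha> \<in> bounded_characters \<rho>"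
    then have \<alpha>: "\<alpha> \<in> characters" and bd: "\<And>a. \<bar>\<alpha> a\<bar> \<le> \<rho> a"
      by (auto simp: bounded_characters_def)
    then have lin: "linear \<alpha>" by (simp add: characters_def)
    have "openin (seminorm_topology {\<rho>}) {x. \<alpha> x \<in> V}" if V: "open V" for V
    proof (subst openin_subopen, intro ballI)
      fix x assume "x \<in> {x. \<alpha> x \<in> V}"
      then obtain r where r: "0 < r" "\<And>t. \<bar>t - \<alpha> x\<bar> < r \<Longrightarrow> t \<in> V"
        using V by (auto simp: open_dist dist_real_def)
      have "openin (seminorm_topology {\<rho>}) {y. \<rho> (y - x) < r}"
        unfolding seminorm_topology_def using r(1) by (intro topology_generated_by_Basis) blast
      moreover have "{y. \<rho> (y - x) < r} \<subseteq> {x. \<alpha> x \<in> V}"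
      proof safe
        fix y assume "\<rho> (y - x) < r"
        with bd[of "y - x"] have "\<bar>\<alpha> y - \<alpha> x\<bar> < r" by (simp add: linear_diff[OF lin])
        then show "\<alpha> y \<in> V" by (rule r(2))
      qed
      moreover have "x \<in> {y. \<rho> (y - x) < r}"
        using r(1) submult_seminorm_zero[OF \<rho>] by simp
      ultimately show "\<exists>T. openin (seminorm_topology {\<rho>}) T \<and> x \<in> T \<and> T \<subseteq> {x. \<alpha> x \<in> V}" by blast
    qed
    then have "continuous_map (seminorm_topology {\<rho>}) euclideanreal \<alpha>"
      by (simp add: continuous_map_def topspace_seminorm_topology[OF F])
    with \<alpha> show "\<alpha> \<in> gelfand_spectrum \<rho>" by (simp add: gelfand_spectrum_def)
  }
qed

section \<open>Density of evaluations\<close>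

lemma character_space_eq: "character_space = top_of_set characters"
  by (simp add: character_space_def euclidean_product_topology)

lemma topspace_character_space [simp]: "topspace character_space = characters"
  by (simp add: character_space_eq)

lemma compactin_character_space: "compactin character_space K \<longleftrightarrow> compact K \<and> K \<subseteq> characters"
  by (simp add: character_space_eq compactin_subtopology)

text \<open>A copy of the function space. The Stone--Weierstrass theorem is stated for a Hausdorff type, which
  the function type itself cannot be.\<close>
datatype 'i point = Point (coordinates: "'i \<Rightarrow> real")

instantiation point :: (type) t2_space
begin

definition open_point :: "'a point set \<Rightarrow> bool" where
  "open_point U \<longleftrightarrow> open (Point -` U)"

instance
proof
  show "open (UNIV :: 'a point set)" by (simp add: open_point_def)
  show "open (U \<inter> V)" if "open U" "open V" for U V :: "'a point set"
    using that by (auto simp: open_point_def)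
  show "open (\<Union>K)" if "\<forall>U\<in>K. open U" for K :: "'a point set set"
    using that by (auto simp: open_point_def vimage_Union)
  fix p q :: "'a point" assume "p \<noteq> q"
  then have "coordinates p \<noteq> coordinates q" using point.expand by blast
  then obtain U V where "open U" "open V" "coordinates p \<in> U" "coordinates q \<in> V" "disjnt U V"
    using Hausdorff_functions unfolding Hausdorff_space_def by (metis UNIV_I open_openin topspace_euclidean)
  moreover have "Point -` coordinates -` W = W" for W :: "('a \<Rightarrow> real) set" by auto
  ultimately show "\<exists>U V. open U \<and> open V \<and> p \<in> U \<and> q \<in> V \<and> U \<inter> V = {}"
    by (intro exI[of _ "coordinates -` U"] exI[of _ "coordinates -` V"])
      (auto simp: open_point_def disjnt_iff)
qed

end

lemma continuous_on_coordinates: "continuous_on S coordinates"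
proof -
  have "Point -` coordinates -` W = W" for W :: "('a \<Rightarrow> real) set" by auto
  then have "continuous_on UNIV (coordinates :: 'a point \<Rightarrow> _)"
    by (simp add: continuous_on_open_vimage open_point_def)
  then show ?thesis by (rule continuous_on_subset) simp
qed

lemma compact_Point_image:
  assumes "compact K"
  shows "compact (Point ` K)"
proof (rule compact_continuous_image[OF _ assms])
  have "continuous_on UNIV (Point :: ('a \<Rightarrow> real) \<Rightarrow> _)"
    by (simp add: continuous_on_open_vimage open_point_def)
  then show "continuous_on K Point" by (rule continuous_on_subset) simp
qed

lemma evaluations_dense:
  fixes K :: "('a::{real_algebra, comm_ring, comm_monoid_mult} \<Rightarrow> real) set"
  assumes K: "compact K" "K \<subseteq> characters" and f: "continuous_on K f" and e: "0 < e"
  obtains a where "\<And>\<alpha>. \<alpha> \<in> K \<Longrightarrow> \<bar>f \<alpha> - \<alpha> a\<bar> \<le> e"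
proof -
  have lin: "linear \<alpha>" and mult: "\<And>x y. \<alpha> (x * y) = \<alpha> x * \<alpha> y" and one: "\<alpha> 1 = 1"
    if "\<alpha> \<in> K" for \<alpha> using K(2) that by (auto simp: characters_def)
  define P where "P g \<longleftrightarrow> (\<exists>a. \<forall>\<alpha>\<in>K. g (Point \<alpha>) = \<alpha> a)" for g :: "'a point \<Rightarrow> real"
  have "\<exists>g. P g \<and> (\<forall>p\<in>Point ` K. \<bar>(f \<circ> coordinates) p - g p\<bar> < e)"
  proof (rule Stone_Weierstrass_HOL[OF compact_Point_image[OF K(1)] _ _ _ _ _ _ e])
    show "P (\<lambda>x. c)" for c
      unfolding P_def by (rule exI[of _ "c *\<^sub>R 1"]) (simp add: linear_scale[OF lin] one)
    show "P (\<lambda>x. g x + h x)" if gh: "P g \<and> P h" for g h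
    proof -
      obtain a b where "\<forall>\<alpha>\<in>K. g (Point \<alpha>) = \<alpha> a" "\<forall>\<alpha>\<in>K. h (Point \<alpha>) = \<alpha> b"
        using gh unfolding P_def by auto
      then show ?thesis unfolding P_def by (intro exI[of _ "a + b"]) (simp add: linear_add[OF lin])
    qed
    show "P (\<lambda>x. g x * h x)" if gh: "P g \<and> P h" for g h
    proof -
      obtain a b where "\<forall>\<alpha>\<in>K. g (Point \<alpha>) = \<alpha> a" "\<forall>\<alpha>\<in>K. h (Point \<alpha>) = \<alpha> b"
        using gh unfolding P_def by auto
      then show ?thesis unfolding P_def by (intro exI[of _ "a * b"]) (simp add: mult)
    qed
    show "continuous_on (Point ` K) g" if "P g" for g
    proof -
      obtain a where a: "\<forall>\<alpha>\<in>K. g (Point \<alpha>) = \<alpha> a" using \<open>P g\<close> unfolding P_def by auto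
      have "continuous_on (Point ` K) (\<lambda>p. coordinates p a)"
        by (rule continuous_on_compose2[OF continuous_on_product_coordinates continuous_on_coordinates]) simp
      then show ?thesis by (rule continuous_on_eq) (use a in auto)
    qed
    show "\<exists>g. P g \<and> g p \<noteq> g q" if pq: "p \<in> Point ` K \<and> q \<in> Point ` K \<and> p \<noteq> q" for p q
    proof -
      have "coordinates p \<noteq> coordinates q" using pq point.expand by blast
      then obtain a where "coordinates p a \<noteq> coordinates q a" by auto
      then show ?thesis unfolding P_def by (intro exI[of _ "\<lambda>p. coordinates p a"]) auto
    qed
    show "continuous_on (Point ` K) (f \<circ> coordinates)"
      by (intro continuous_on_compose continuous_on_coordinates) (simp add: image_image f)
  qed
  then obtain g where g: "P g" "\<And>\<alpha>. \<alpha> \<in> K \<Longrightarrow> \<bar>f \<alpha> - g (Point \<alpha>)\<bar> < e" by auto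
  then obtain a where "\<forall>\<alpha>\<in>K. g (Point \<alpha>) = \<alpha> a" unfolding P_def by auto
  with g(2) show thesis by (intro that[of a]) (auto intro: less_imp_le)
qed

section \<open>Uniqueness of the representing measure\<close>

lemma radon_measureD:
  assumes "radon_measure T \<mu>"
  shows "space \<mu> = topspace T" "sets \<mu> = sigma_sets (topspace T) {U. openin T U}"
    "\<And>U. openin T U \<Longrightarrow> U \<in> sets \<mu>"
    "\<And>B. B \<in> sets \<mu> \<Longrightarrow> emeasure \<mu> B = (SUP K\<in>{K. compactin T K \<and> K \<subseteq> B}. emeasure \<mu> K)"
  using assms by (auto simp: radon_measure_def sigma_sets.Basic)

lemma radon_measure_closedin:
  assumes "radon_measure T \<mu>" "closedin T C"
  shows "C \<in> sets \<mu>"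
proof -
  have "C = space \<mu> - (topspace T - C)"
    using closedin_subset[OF assms(2)] radon_measureD(1)[OF assms(1)] by auto
  moreover have "topspace T - C \<in> sets \<mu>"
    using assms by (intro radon_measureD(3)) auto
  ultimately show ?thesis by (metis sets.compl_sets)
qed

lemma closedin_compact_characters:
  assumes "compact K" "K \<subseteq> characters"
  shows "closedin character_space K"
  using assms compact_imp_closed_fun[of K] by (auto simp: character_space_eq intro!: closed_subset)

lemma openin_evaluation_gt: "openin character_space {\<alpha> \<in> characters. c < \<bar>\<alpha> a\<bar>}"
proof -
  have "continuous_map character_space euclideanreal (\<lambda>\<alpha>. \<bar>\<alpha> a\<bar>)"
    unfolding character_space_eq continuous_map_iff_continuous
    by (intro continuous_intros continuous_on_subset[OF continuous_on_product_coordinates]) auto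
  from openin_continuous_map_preimage[OF this, of "{c<..}"] show ?thesis by simp
qed

lemma finite_measure_representing:
  assumes "radon_measure character_space \<nu>" "represented_by L \<nu>"
  shows "finite_measure \<nu>"
proof
  have "integrable \<nu> (\<lambda>\<alpha>. \<alpha> 1)" using assms(2) by (simp add: represented_by_def)
  then have "integrable \<nu> (\<lambda>\<alpha>. 1 :: real)"
    using radon_measureD(1)[OF assms(1)]
    by (subst Bochner_Integration.integrable_cong[of _ _ _ "\<lambda>\<alpha>. \<alpha> 1"]) (auto simp: characters_def)
  then show "emeasure \<nu> (space \<nu>) \<noteq> \<infinity>" by (simp add: integrable_iff_bounded)
qed

text \<open>For \<open>c > \<rho> a\<close>, Markov's inequality for \<open>\<alpha> \<mapsto> \<alpha> a ^ (2 * n)\<close> bounds the measure of \<open>{\<bar>\<alpha> a\<bar> > c}\<close> by a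
  constant times \<open>(\<rho> a / c) ^ (2 * n)\<close>, and \<open>n\<close> is arbitrary.\<close>
lemma emeasure_evaluation_gt_eq_0:
  fixes \<nu> :: "('a::{real_algebra, comm_ring, comm_monoid_mult} \<Rightarrow> real) measure"
  assumes \<nu>: "radon_measure character_space \<nu>" "represented_by L \<nu>"
    and \<rho>: "submult_seminorm \<rho>" and L: "0 < C" "\<And>x. \<bar>L x\<bar> \<le> C * \<rho> x"
  shows "emeasure \<nu> {\<alpha> \<in> characters. \<rho> a < \<bar>\<alpha> a\<bar>} = 0"
proof -
  interpret finite_measure \<nu> by (rule finite_measure_representing[OF \<nu>])
  note sp = radon_measureD(1)[OF \<nu>(1)]
  have R: "0 \<le> \<rho> a" by (rule submult_seminormD(1)[OF \<rho>])
  have null: "measure \<nu> {\<alpha> \<in> characters. c < \<bar>\<alpha> a\<bar>} = 0" if c: "\<rho> a < c" for c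
  proof -
    have c0: "0 < c" using c R by simp
    let ?B = "{\<alpha> \<in> characters. c < \<bar>\<alpha> a\<bar>}"
    have bound: "measure \<nu> ?B \<le> (C * max 1 (\<rho> 1)) * ((\<rho> a / c) ^ 2) ^ n" for n
    proof -
      have int: "integrable \<nu> (\<lambda>\<alpha>. \<alpha> (a ^ (2 * n)))" and Lint: "L (a ^ (2 * n)) = (\<integral>\<alpha>. \<alpha> (a ^ (2 * n)) \<partial>\<nu>)"
        using \<nu>(2) by (auto simp: represented_by_def)
      have pow: "\<alpha> (a ^ k) = \<alpha> a ^ k" if "\<alpha> \<in> characters" for \<alpha> k
        using that by (induction k) (auto simp: characters_def)
      have meas: "{\<alpha> \<in> space \<nu>. c ^ (2 * n) \<le> \<alpha> (a ^ (2 * n))} \<in> sets \<nu>"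
        using borel_measurable_integrable[OF int] by measurable
      have "measure \<nu> ?B \<le> measure \<nu> {\<alpha> \<in> space \<nu>. c ^ (2 * n) \<le> \<alpha> (a ^ (2 * n))}"
      proof (rule finite_measure_mono[OF _ meas], safe)
        fix \<alpha> assume \<alpha>: "\<alpha> \<in> characters" "c < \<bar>\<alpha> a\<bar>"
        then show "\<alpha> \<in> space \<nu>" by (simp add: sp)
        have "c ^ (2 * n) \<le> \<bar>\<alpha> a\<bar> ^ (2 * n)" using \<alpha>(2) c0 by (intro power_mono) auto
        then show "c ^ (2 * n) \<le> \<alpha> (a ^ (2 * n))" by (simp add: pow[OF \<alpha>(1)] power_even_abs)
      qed
      also have "\<dots> \<le> (\<integral>\<alpha>. \<alpha> (a ^ (2 * n)) \<partial>\<nu>) / c ^ (2 * n)"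
        using c0 by (intro integral_Markov_inequality_measure[OF int sets.top] AE_I2) (auto simp: sp pow)
      also have "\<dots> \<le> (C * (max 1 (\<rho> 1) * \<rho> a ^ (2 * n))) / c ^ (2 * n)"
      proof (intro divide_right_mono)
        have "L (a ^ (2 * n)) \<le> C * \<rho> (a ^ (2 * n))" using L(2)[of "a ^ (2 * n)"] by simp
        also have "\<dots> \<le> C * (max 1 (\<rho> 1) * \<rho> a ^ (2 * n))"
          using L(1) by (intro mult_left_mono submult_seminorm_power[OF \<rho>]) auto
        finally show "(\<integral>\<alpha>. \<alpha> (a ^ (2 * n)) \<partial>\<nu>) \<le> C * (max 1 (\<rho> 1) * \<rho> a ^ (2 * n))"
          using Lint by simp
      qed (use c0 in auto)
      finally show ?thesis by (simp add: power_mult power_divide mult.assoc)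
    qed
    have "\<rho> a / c < 1" "0 \<le> \<rho> a / c" using c c0 R by auto
    then have "(\<rho> a / c) ^ 2 < 1" by (simp add: power_less_one_iff abs_square_less_1)
    then have "(\<lambda>n. (C * max 1 (\<rho> 1)) * ((\<rho> a / c) ^ 2) ^ n) \<longlonglongrightarrow> 0"
      by (intro tendsto_mult_right_zero LIMSEQ_realpow_zero) auto
    then have "measure \<nu> ?B \<le> 0"
      by (rule LIMSEQ_le_const) (use bound in auto)
    then show ?thesis using measure_nonneg[of \<nu> ?B] by linarith
  qed
  let ?B = "\<lambda>n. {\<alpha> \<in> characters. \<rho> a + 1 / real (Suc n) < \<bar>\<alpha> a\<bar>}"
  have "{\<alpha> \<in> characters. \<rho> a < \<bar>\<alpha> a\<bar>} = (\<Union>n. ?B n)"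
  proof (intro equalityI subsetI)
    fix \<alpha> assume \<alpha>: "\<alpha> \<in> {\<alpha> \<in> characters. \<rho> a < \<bar>\<alpha> a\<bar>}"
    then obtain n where "1 / real (Suc n) < \<bar>\<alpha> a\<bar> - \<rho> a"
      using reals_Archimedean[of "\<bar>\<alpha> a\<bar> - \<rho> a"] by (auto simp: inverse_eq_divide)
    then show "\<alpha> \<in> (\<Union>n. ?B n)" using \<alpha> by (intro UN_I[of n]) (auto simp: algebra_simps)
  next
    fix \<alpha> assume "\<alpha> \<in> (\<Union>n. ?B n)"
    then obtain n where "\<alpha> \<in> characters" "\<rho> a + 1 / real (Suc n) < \<bar>\<alpha> a\<bar>" by blast
    moreover have "0 < 1 / real (Suc n)" by simp
    ultimately have "\<alpha> \<in> characters \<and> \<rho> a < \<bar>\<alpha> a\<bar>" by linarith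
    then show "\<alpha> \<in> {\<alpha> \<in> characters. \<rho> a < \<bar>\<alpha> a\<bar>}" by simp
  qed
  moreover have "emeasure \<nu> (?B n) = 0" for n
    using null[of "\<rho> a + 1 / real (Suc n)"] by (simp add: emeasure_eq_measure)
  then have "emeasure \<nu> (\<Union>n. ?B n) = 0"
    using radon_measureD(3)[OF \<nu>(1) openin_evaluation_gt] by (intro emeasure_UN_eq_0) auto
  ultimately show ?thesis by simp
qed

text \<open>The complement is an uncountable union of open null sets, but a compact subset of it is covered by
  finitely many of them; inner regularity does the rest.\<close>
lemma representing_measure_concentrated:
  fixes \<nu> :: "('a::{real_algebra, comm_ring, comm_monoid_mult} \<Rightarrow> real) measure"
  assumes \<nu>: "radon_measure character_space \<nu>" "represented_by L \<nu>"
    and \<rho>: "submult_seminorm \<rho>" and L: "0 < C" "\<And>x. \<bar>L x\<bar> \<le> C * \<rho> x"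
  shows "emeasure \<nu> (characters - bounded_characters \<rho>) = 0"
proof -
  let ?U = "\<lambda>a. {\<alpha> \<in> characters. \<rho> a < \<bar>\<alpha> a\<bar>}"
  have oU: "openin character_space (?U a)" for a by (rule openin_evaluation_gt)
  have "openin character_space (\<Union>a. ?U a)" by (intro openin_Union) (auto simp: oU)
  moreover have eq: "characters - bounded_characters \<rho> = (\<Union>a. ?U a)"
    by (auto simp: bounded_characters_def simp flip: not_le)
  ultimately have sets: "characters - bounded_characters \<rho> \<in> sets \<nu>"
    using radon_measureD(3)[OF \<nu>(1)] by simp
  have "emeasure \<nu> K = 0" if K: "compactin character_space K" "K \<subseteq> characters - bounded_characters \<rho>" for K
  proof -
    obtain \<F> where F: "finite \<F>" "\<F> \<subseteq> range ?U" "K \<subseteq> \<Union>\<F>"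
      using K oU unfolding compactin_def eq by (auto 0 4 dest!: spec[of _ "range ?U"])
    have "emeasure \<nu> V = 0" "V \<in> sets \<nu>" if "V \<in> \<F>" for V
      using F(2) that emeasure_evaluation_gt_eq_0[OF \<nu> \<rho> L] radon_measureD(3)[OF \<nu>(1) oU] by auto
    then have "(\<Union>\<F>) \<in> null_sets \<nu>"
      using F(1) by (intro null_sets.finite_Union) (auto simp: null_sets_def)
    then show ?thesis using emeasure_mono[OF F(3), of \<nu>] by (auto simp: null_sets_def)
  qed
  then have "(SUP K\<in>{K. compactin character_space K \<and> K \<subseteq> characters - bounded_characters \<rho>}. emeasure \<nu> K) \<le> 0"
    by (intro SUP_least) auto
  then show ?thesis using radon_measureD(4)[OF \<nu>(1) sets] by simp
qed

text \<open>Choose a compact \<open>D \<subseteq> G - C\<close> that nearly exhausts \<open>G - C\<close> for \<open>\<nu>2\<close>, a Urysohn function equal to \<open>1\<close> on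
  \<open>C\<close> and \<open>0\<close> on \<open>D\<close>, and an element \<open>a\<close> whose evaluation approximates it on \<open>G\<close>. Both measures give
  \<open>\<alpha> \<mapsto> \<alpha> a\<close> the integral \<open>L a\<close>, which up to small errors is at least \<open>\<nu>1 C\<close> and at most
  \<open>\<nu>2 (G - D)\<close>, hence at most \<open>\<nu>2 C\<close>.\<close>
lemma concentrated_compact_le:
  fixes \<nu>1 \<nu>2 :: "('a::{real_algebra, comm_ring, comm_monoid_mult} \<Rightarrow> real) measure"
  assumes \<nu>1: "radon_measure character_space \<nu>1" "represented_by L \<nu>1" "emeasure \<nu>1 (characters - G) = 0"
    and \<nu>2: "radon_measure character_space \<nu>2" "represented_by L \<nu>2" "emeasure \<nu>2 (characters - G) = 0"
    and G: "compact G" "G \<subseteq> characters" and C: "compact C" "C \<subseteq> G"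
  shows "measure \<nu>1 C \<le> measure \<nu>2 C"
proof (rule field_le_epsilon)
  interpret n1: finite_measure \<nu>1 by (rule finite_measure_representing[OF \<nu>1(1,2)])
  interpret n2: finite_measure \<nu>2 by (rule finite_measure_representing[OF \<nu>2(1,2)])
  note sp = radon_measureD(1)[OF \<nu>1(1)] radon_measureD(1)[OF \<nu>2(1)]
  have closed: "closedin character_space D" if "compact D" "D \<subseteq> G" for D
    using closedin_compact_characters that G(2) by blast
  have ms: "D \<in> sets \<nu>1" "D \<in> sets \<nu>2" if "compact D" "D \<subseteq> G" for D
    using radon_measure_closedin[OF \<nu>1(1) closed[OF that]] radon_measure_closedin[OF \<nu>2(1) closed[OF that]] by auto
  have compl: "characters - G \<in> sets \<nu>1" "characters - G \<in> sets \<nu>2"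
    using sets.compl_sets[OF ms(1)[OF G(1) order_refl]] sets.compl_sets[OF ms(2)[OF G(1) order_refl]] by (auto simp: sp)
  have ae1: "AE \<alpha> in \<nu>1. \<alpha> \<in> G"
    using \<nu>1(3) compl(1) by (intro AE_I[of _ _ "characters - G"]) (auto simp: sp)
  have ae2: "AE \<alpha> in \<nu>2. \<alpha> \<in> G"
    using \<nu>2(3) compl(2) by (intro AE_I[of _ _ "characters - G"]) (auto simp: sp)
  fix e :: real assume e: "0 < e"
  \<comment> \<open>The total error is \<open>d\<close> from the choice of \<open>D\<close> and \<open>d * L 1\<close> from each of the two measures.\<close>
  define d where "d = e / (1 + 2 * L 1)"
  have L1: "L 1 = measure \<nu>1 characters" "L 1 = measure \<nu>2 characters"
  proof -
    have "L 1 = (\<integral>\<alpha>. \<alpha> 1 \<partial>\<nu>1)" "L 1 = (\<integral>\<alpha>. \<alpha> 1 \<partial>\<nu>2)"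
      using \<nu>1(2) \<nu>2(2) by (auto simp: represented_by_def)
    moreover have "(\<integral>\<alpha>. \<alpha> 1 \<partial>\<nu>1) = (\<integral>\<alpha>. 1 \<partial>\<nu>1)" "(\<integral>\<alpha>. \<alpha> 1 \<partial>\<nu>2) = (\<integral>\<alpha>. 1 \<partial>\<nu>2)"
      by (intro Bochner_Integration.integral_cong; simp add: sp characters_def)+
    ultimately show "L 1 = measure \<nu>1 characters" "L 1 = measure \<nu>2 characters" by (simp_all add: sp)
  qed
  have pos: "0 < 1 + 2 * L 1" using L1(1) measure_nonneg[of \<nu>1 characters] by linarith
  have "d + 2 * d * L 1 = d * (1 + 2 * L 1)" by (simp add: algebra_simps)
  then have d: "0 < d" "d + 2 * d * L 1 = e" using e pos by (auto simp: d_def)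
  have GC: "G - C \<in> sets \<nu>2" using ms(2)[OF G(1) order_refl] ms(2)[OF C] by (rule sets.Diff)
  obtain D where D: "compact D" "D \<subseteq> G - C" "measure \<nu>2 (G - C) \<le> measure \<nu>2 D + d"
  proof -
    have sup: "emeasure \<nu>2 (G - C) = (SUP K\<in>{K. compactin character_space K \<and> K \<subseteq> G - C}. emeasure \<nu>2 K)"
      by (rule radon_measureD(4)[OF \<nu>2(1) GC])
    have "\<exists>K. compactin character_space K \<and> K \<subseteq> G - C \<and> measure \<nu>2 (G - C) \<le> measure \<nu>2 K + d"
    proof (rule ccontr)
      assume contra: "\<not> ?thesis"
      have *: "measure \<nu>2 K \<le> measure \<nu>2 (G - C) - d"
        if "compactin character_space K" "K \<subseteq> G - C" for K
      proof -
        have "\<not> measure \<nu>2 (G - C) \<le> measure \<nu>2 K + d" using contra that by blast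
        then show ?thesis by linarith
      qed
      have "0 \<le> measure \<nu>2 (G - C) - d" using *[of "{}"] by simp
      moreover have "emeasure \<nu>2 (G - C) \<le> ennreal (measure \<nu>2 (G - C) - d)"
        unfolding sup by (rule SUP_least) (simp add: n2.emeasure_eq_measure * ennreal_leI)
      ultimately have "measure \<nu>2 (G - C) \<le> measure \<nu>2 (G - C) - d"
        by (simp add: n2.emeasure_eq_measure)
      with d(1) show False by simp
    qed
    then obtain K where "compactin character_space K" "K \<subseteq> G - C" "measure \<nu>2 (G - C) \<le> measure \<nu>2 K + d"
      by blast
    then show thesis by (intro that[of K]) (simp_all add: compactin_character_space)
  qed
  have mD: "D \<in> sets \<nu>2" and DG: "D \<subseteq> G" using ms(2)[OF D(1)] D(2) by auto
  have "closedin (top_of_set G) C" "closedin (top_of_set G) D"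
    using C D(1,2) compact_imp_closed_fun by (auto intro!: closed_subset)
  moreover have "disjnt D C" using D(2) by (auto simp: disjnt_def)
  moreover have "normal_space (top_of_set G)"
    using G(1) Hausdorff_space_subtopology[OF Hausdorff_functions]
    by (intro compact_Hausdorff_or_regular_imp_normal_space) (auto simp: compact_space_subtopology)
  ultimately obtain f :: "('a \<Rightarrow> real) \<Rightarrow> real" where f: "continuous_map (top_of_set G) (top_of_set {0..1}) f" "f ` D \<subseteq> {0}" "f ` C \<subseteq> {1}"
    using Urysohn_lemma[of "top_of_set G" D C 0 1] by auto
  have fc: "continuous_on G f" and f01: "\<And>\<alpha>. \<alpha> \<in> G \<Longrightarrow> 0 \<le> f \<alpha> \<and> f \<alpha> \<le> 1"
    using f(1) by (auto simp: continuous_map_in_subtopology)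
  obtain a where a: "\<And>\<alpha>. \<alpha> \<in> G \<Longrightarrow> \<bar>f \<alpha> - \<alpha> a\<bar> \<le> d"
    using evaluations_dense[OF G fc d(1)] by blast
  have int: "integrable \<nu>1 (\<lambda>\<alpha>. \<alpha> a)" "integrable \<nu>2 (\<lambda>\<alpha>. \<alpha> a)"
    and La: "L a = (\<integral>\<alpha>. \<alpha> a \<partial>\<nu>1)" "L a = (\<integral>\<alpha>. \<alpha> a \<partial>\<nu>2)"
    using \<nu>1(2) \<nu>2(2) by (auto simp: represented_by_def)
  have "measure \<nu>1 C = (\<integral>\<alpha>. indicator C \<alpha> \<partial>\<nu>1)"
    using ms(1)[OF C] by (simp add: n1.emeasure_eq_measure Int_absorb2 sets.sets_into_space)
  also have "\<dots> \<le> (\<integral>\<alpha>. \<alpha> a + d \<partial>\<nu>1)"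
  proof (rule integral_mono_AE)
    show "AE \<alpha> in \<nu>1. indicator C \<alpha> \<le> \<alpha> a + d"
      using ae1
    proof eventually_elim
      case (elim \<alpha>)
      show ?case using a[OF elim] f01[OF elim] f(3) by (cases "\<alpha> \<in> C") (auto simp: abs_le_iff)
    qed
  qed (use int ms(1)[OF C] in \<open>auto simp: n1.emeasure_eq_measure\<close>)
  also have "\<dots> = L a + d * L 1" using int(1) La(1) L1(1) by (simp add: sp)
  also have "\<dots> = (\<integral>\<alpha>. \<alpha> a - d \<partial>\<nu>2) + 2 * d * L 1" using int(2) La(2) L1(2) by (simp add: sp)
  also have "(\<integral>\<alpha>. \<alpha> a - d \<partial>\<nu>2) \<le> (\<integral>\<alpha>. indicator (G - D) \<alpha> \<partial>\<nu>2)"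
  proof (rule integral_mono_AE)
    have "G - D \<in> sets \<nu>2" using ms(2)[OF G(1) order_refl] mD by blast
    then show "integrable \<nu>2 (indicator (G - D) :: _ \<Rightarrow> real)" by (auto simp: n2.emeasure_eq_measure)
    show "AE \<alpha> in \<nu>2. \<alpha> a - d \<le> indicator (G - D) \<alpha>"
      using ae2
    proof eventually_elim
      case (elim \<alpha>)
      show ?case using a[OF elim] f01[OF elim] f(2) elim by (cases "\<alpha> \<in> D") (auto simp: abs_le_iff)
    qed
  qed (use int in auto)
  also have "(\<integral>\<alpha>. indicator (G - D) \<alpha> \<partial>\<nu>2) = measure \<nu>2 (G - D)"
    using ms(2)[OF G(1) order_refl] mD G(2) by (simp add: sp Int_absorb2 subset_iff)
  also have "measure \<nu>2 (G - D) = measure \<nu>2 G - measure \<nu>2 D"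
    using ms(2)[OF G(1) order_refl] mD DG by (intro n2.finite_measure_Diff) auto
  also have "measure \<nu>2 G = measure \<nu>2 (G - C) + measure \<nu>2 C"
    using n2.finite_measure_Diff[OF ms(2)[OF G(1) order_refl] ms(2)[OF C] C(2)] by simp
  finally have "measure \<nu>1 C \<le> measure \<nu>2 C + (d + 2 * d * L 1)" using D(3) by simp
  then show "measure \<nu>1 C \<le> measure \<nu>2 C + e" unfolding d(2) .
qed

lemma concentrated_representing_measures_eq:
  fixes \<nu>1 \<nu>2 :: "('a::{real_algebra, comm_ring, comm_monoid_mult} \<Rightarrow> real) measure"
  assumes \<nu>1: "radon_measure character_space \<nu>1" "represented_by L \<nu>1" "emeasure \<nu>1 (characters - G) = 0"
    and \<nu>2: "radon_measure character_space \<nu>2" "represented_by L \<nu>2" "emeasure \<nu>2 (characters - G) = 0"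
    and G: "compact G" "G \<subseteq> characters"
  shows "\<nu>1 = \<nu>2"
proof (rule measure_eqI)
  interpret n1: finite_measure \<nu>1 by (rule finite_measure_representing[OF \<nu>1(1,2)])
  interpret n2: finite_measure \<nu>2 by (rule finite_measure_representing[OF \<nu>2(1,2)])
  show sets: "sets \<nu>1 = sets \<nu>2" using radon_measureD(2)[OF \<nu>1(1)] radon_measureD(2)[OF \<nu>2(1)] by simp
  have restrict: "emeasure \<nu> K = emeasure \<nu> (K \<inter> G)"
    if \<nu>: "radon_measure character_space \<nu>" "emeasure \<nu> (characters - G) = 0" and K: "compactin character_space K" for \<nu> K
  proof -
    have cl: "closedin character_space K" "closedin character_space G"
      using K G closedin_compact_characters by (auto simp: compactin_character_space)
    then have s: "K \<in> sets \<nu>" "K \<inter> G \<in> sets \<nu>" "characters - G \<in> sets \<nu>"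
      using radon_measure_closedin[OF \<nu>(1)] radon_measureD(3)[OF \<nu>(1), of "characters - G"]
      by (auto simp: closedin_def)
    have "emeasure \<nu> K \<le> emeasure \<nu> ((K \<inter> G) \<union> (characters - G))"
      using K s by (intro emeasure_mono) (auto simp: compactin_character_space)
    also have "\<dots> \<le> emeasure \<nu> (K \<inter> G) + emeasure \<nu> (characters - G)"
      using s by (intro emeasure_subadditive) auto
    finally have "emeasure \<nu> K \<le> emeasure \<nu> (K \<inter> G)" using \<nu>(2) by simp
    moreover have "emeasure \<nu> (K \<inter> G) \<le> emeasure \<nu> K" using s by (intro emeasure_mono) auto
    ultimately show ?thesis by (rule antisym)
  qed
  have compact_eq: "emeasure \<nu>1 K = emeasure \<nu>2 K" if K: "compactin character_space K" for K
  proof -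
    have "compact (K \<inter> G)" "K \<inter> G \<subseteq> G"
      using K G(1) compact_imp_closed_fun[OF G(1)] by (auto simp: compactin_character_space intro: compact_Int_closed)
    then have "measure \<nu>1 (K \<inter> G) = measure \<nu>2 (K \<inter> G)"
      using concentrated_compact_le[OF \<nu>1 \<nu>2 G] concentrated_compact_le[OF \<nu>2 \<nu>1 G] by (metis antisym)
    then show ?thesis
      using restrict[OF \<nu>1(1,3) K] restrict[OF \<nu>2(1,3) K]
      by (simp add: n1.emeasure_eq_measure n2.emeasure_eq_measure)
  qed
  fix B assume B: "B \<in> sets \<nu>1"
  have "(SUP K\<in>{K. compactin character_space K \<and> K \<subseteq> B}. emeasure \<nu>1 K) = (SUP K\<in>{K. compactin character_space K \<and> K \<subseteq> B}. emeasure \<nu>2 K)"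
    by (intro SUP_cong refl) (auto intro: compact_eq)
  then show "emeasure \<nu>1 B = emeasure \<nu>2 B"
    using radon_measureD(4)[OF \<nu>1(1) B] radon_measureD(4)[OF \<nu>2(1), of B] B sets by simp
qed

section \<open>Existence of the representing measure\<close>

lemma radon_measure_extend:
  assumes T: "Hausdorff_space T" and K: "compactin T K"
    and \<mu>: "radon_measure (subtopology T K) \<mu>" "finite_measure \<mu>"
  defines "\<nu> \<equiv> distr \<mu> (sigma (topspace T) {U. openin T U}) (\<lambda>x. x)"
  shows "radon_measure T \<nu>" "emeasure \<nu> (topspace T - K) = 0"
    "(\<lambda>x. x) \<in> measurable \<mu> (sigma (topspace T) {U. openin T U})"
proof -
  let ?N = "sigma (topspace T) {U. openin T U}"
  have KT: "K \<subseteq> topspace T" using K by (rule compactin_subset_topspace)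
  have sp: "space \<mu> = K" using radon_measureD(1)[OF \<mu>(1)] KT by (simp add: Int_absorb1)
  have pow: "{U. openin T U} \<subseteq> Pow (topspace T)" by (auto dest: openin_subset)
  have N: "space ?N = topspace T" "sets ?N = sigma_sets (topspace T) {U. openin T U}"
    using pow by (auto simp: space_measure_of sets_measure_of)
  show id: "(\<lambda>x. x) \<in> measurable \<mu> ?N"
  proof (rule measurable_measure_of[OF pow])
    show "(\<lambda>x. x) \<in> space \<mu> \<rightarrow> topspace T" using sp KT by auto
    fix U assume "U \<in> {U. openin T U}"
    then have "openin (subtopology T K) (U \<inter> K)" by (auto simp: openin_subtopology)
    then show "(\<lambda>x. x) -` U \<inter> space \<mu> \<in> sets \<mu>"
      using radon_measureD(3)[OF \<mu>(1)] sp by simp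
  qed
  have em: "emeasure \<nu> B = emeasure \<mu> (B \<inter> K)" if "B \<in> sigma_sets (topspace T) {U. openin T U}" for B
    unfolding \<nu>_def using emeasure_distr[OF id, of B] that N sp by simp
  have compact_sets: "C \<in> sigma_sets (topspace T) {U. openin T U}" if "compactin T C" for C
  proof -
    have cl: "closedin T C" by (rule compactin_imp_closedin[OF T that])
    have "topspace T - (topspace T - C) \<in> sigma_sets (topspace T) {U. openin T U}"
      using cl by (intro sigma_sets.Compl sigma_sets.Basic) auto
    then show ?thesis using closedin_subset[OF cl] by (simp add: double_diff)
  qed
  interpret finite_measure \<mu> by (rule \<mu>(2))
  show "radon_measure T \<nu>"
    unfolding radon_measure_def
  proof (intro conjI ballI)
    show "space \<nu> = topspace T" "sets \<nu> = sigma_sets (topspace T) {U. openin T U}"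
      by (simp_all add: \<nu>_def N)
    show "\<exists>U. openin T U \<and> x \<in> U \<and> emeasure \<nu> U < \<infinity>" if "x \<in> topspace T" for x
      using that emeasure_finite[of "topspace T \<inter> K"]
      by (intro exI[of _ "topspace T"]) (simp add: em sigma_sets_top flip: less_top)
    fix B assume "B \<in> sets \<nu>"
    then have B: "B \<in> sigma_sets (topspace T) {U. openin T U}" by (simp add: \<nu>_def N)
    have BK: "B \<inter> K \<in> sets \<mu>" using measurable_sets[OF id, of B] B N sp by simp
    have "emeasure \<nu> B = emeasure \<mu> (B \<inter> K)" by (rule em[OF B])
    also have "\<dots> = (SUP C\<in>{C. compactin (subtopology T K) C \<and> C \<subseteq> B \<inter> K}. emeasure \<mu> C)"
      by (rule radon_measureD(4)[OF \<mu>(1) BK])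
    also have "\<dots> = (SUP C\<in>{C. compactin T C \<and> C \<subseteq> B}. emeasure \<nu> C)"
    proof (rule antisym)
      show "(SUP C\<in>{C. compactin (subtopology T K) C \<and> C \<subseteq> B \<inter> K}. emeasure \<mu> C)
          \<le> (SUP C\<in>{C. compactin T C \<and> C \<subseteq> B}. emeasure \<nu> C)"
      proof (rule SUP_least)
        fix C assume "C \<in> {C. compactin (subtopology T K) C \<and> C \<subseteq> B \<inter> K}"
        then have C: "compactin T C" "C \<subseteq> B" "C \<inter> K = C" by (auto simp: compactin_subtopology)
        have "emeasure \<mu> C = emeasure \<nu> C" using em[OF compact_sets[OF C(1)]] C(3) by simp
        also have "\<dots> \<le> (SUP C\<in>{C. compactin T C \<and> C \<subseteq> B}. emeasure \<nu> C)"
          using C by (intro SUP_upper) auto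
        finally show "emeasure \<mu> C \<le> (SUP C\<in>{C. compactin T C \<and> C \<subseteq> B}. emeasure \<nu> C)" .
      qed
      show "(SUP C\<in>{C. compactin T C \<and> C \<subseteq> B}. emeasure \<nu> C)
          \<le> (SUP C\<in>{C. compactin (subtopology T K) C \<and> C \<subseteq> B \<inter> K}. emeasure \<mu> C)"
      proof (rule SUP_least)
        fix C assume "C \<in> {C. compactin T C \<and> C \<subseteq> B}"
        then have C: "compactin T C" "C \<subseteq> B" by auto
        have "compactin (subtopology T K) (C \<inter> K)"
          using compactin_Int[OF T C(1) K] by (simp add: compactin_subtopology)
        then show "emeasure \<nu> C \<le> (SUP C\<in>{C. compactin (subtopology T K) C \<and> C \<subseteq> B \<inter> K}. emeasure \<mu> C)"
          unfolding em[OF compact_sets[OF C(1)]] using C(2) by (intro SUP_upper) auto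
      qed
    qed
    finally show "emeasure \<nu> B = (SUP C\<in>{C. compactin T C \<and> C \<subseteq> B}. emeasure \<nu> C)" .
  qed
  have "topspace T - K \<in> sigma_sets (topspace T) {U. openin T U}"
    by (intro sigma_sets.Compl compact_sets K)
  then show "emeasure \<nu> (topspace T - K) = 0"
    using em[of "topspace T - K"] by (simp add: Int_commute)
qed

text \<open>For continuous \<open>f\<close> on \<open>K\<close>, the upper envelope \<open>\<Lambda> f = Inf {L b | b. f \<le> b on K}\<close> is within \<open>e * L 1\<close> of
  \<open>L a\<close> as soon as the evaluation at \<open>a\<close> is within \<open>e\<close> of \<open>f\<close>. Since evaluations are dense, linearity
  and monotonicity of \<open>\<Lambda>\<close> follow from those of \<open>L\<close>.\<close>
lemma represented_by_measure_on_compact: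
  fixes L :: "'a::{real_algebra, comm_ring, comm_monoid_mult} \<Rightarrow> real"
  assumes K: "compact K" "K \<subseteq> characters" and L: "linear L"
    and pos: "\<And>a. (\<And>\<alpha>. \<alpha> \<in> K \<Longrightarrow> 0 \<le> \<alpha> a) \<Longrightarrow> 0 \<le> L a"
  obtains \<mu> where "radon_measure character_space \<mu>" "represented_by L \<mu>" "emeasure \<mu> (characters - K) = 0"
proof -
  have lin: "linear \<alpha>" and one: "\<alpha> 1 = 1" if "\<alpha> \<in> K" for \<alpha>
    using K(2) that by (auto simp: characters_def)
  have L1: "0 \<le> L 1" by (rule pos) (simp add: one)
  have L_mono: "L a \<le> L b" if "\<And>\<alpha>. \<alpha> \<in> K \<Longrightarrow> \<alpha> a \<le> \<alpha> b" for a b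
    using pos[of "b - a"] that by (simp add: linear_diff[OF L] linear_diff[OF lin])
  define \<Lambda> where "\<Lambda> f = Inf {L b | b. \<forall>\<alpha>\<in>K. f \<alpha> \<le> \<alpha> b}" for f :: "('a \<Rightarrow> real) \<Rightarrow> real"
  have near: "\<bar>\<Lambda> f - L a\<bar> \<le> e * L 1" if a: "\<And>\<alpha>. \<alpha> \<in> K \<Longrightarrow> \<bar>f \<alpha> - \<alpha> a\<bar> \<le> e" for f a e
  proof -
    let ?A = "{L b | b. \<forall>\<alpha>\<in>K. f \<alpha> \<le> \<alpha> b}"
    have "f \<alpha> \<le> \<alpha> (a + e *\<^sub>R 1)" if "\<alpha> \<in> K" for \<alpha>
      using a[OF that] by (simp add: linear_add[OF lin[OF that]] linear_scale[OF lin[OF that]] one[OF that] abs_le_iff)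
    then have up: "L a + e * L 1 \<in> ?A"
      by (intro CollectI exI[of _ "a + e *\<^sub>R 1"]) (simp add: linear_add[OF L] linear_scale[OF L])
    have lo: "L a - e * L 1 \<le> y" if y: "y \<in> ?A" for y
    proof -
      obtain b where b: "y = L b" "\<forall>\<alpha>\<in>K. f \<alpha> \<le> \<alpha> b" using y by blast
      have "L (a - e *\<^sub>R 1) \<le> L b"
      proof (rule L_mono)
        fix \<alpha> assume \<alpha>: "\<alpha> \<in> K"
        have "\<alpha> (a - e *\<^sub>R 1) = \<alpha> a - e" by (simp add: linear_diff[OF lin[OF \<alpha>]] linear_scale[OF lin[OF \<alpha>]] one[OF \<alpha>])
        then show "\<alpha> (a - e *\<^sub>R 1) \<le> \<alpha> b" using a[OF \<alpha>] bspec[OF b(2) \<alpha>] by linarith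
      qed
      then show ?thesis by (simp add: b(1) linear_diff[OF L] linear_scale[OF L])
    qed
    have "\<Lambda> f \<le> L a + e * L 1"
      unfolding \<Lambda>_def by (rule cInf_lower[OF up bdd_belowI[OF lo]])
    moreover have "L a - e * L 1 \<le> \<Lambda> f"
      unfolding \<Lambda>_def by (rule cInf_greatest[OF _ lo]) (use up in blast)
    ultimately show ?thesis by linarith
  qed
  have vanish: "x \<le> y" if "\<And>e. 0 < e \<Longrightarrow> x \<le> y + e * M" "0 \<le> M" for x y M :: real
  proof (rule field_le_epsilon)
    fix e :: real assume "0 < e"
    then have "x \<le> y + (e / (M + 1)) * M" using that by (intro that(1)) simp
    also have "(e / (M + 1)) * M \<le> e" using \<open>0 < e\<close> that(2) by (simp add: field_simps)
    finally show "x \<le> y + e" by simp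
  qed
  let ?X = "top_of_set K"
  interpret positive_functional ?X \<Lambda>
  proof
    show "compact_space ?X" using K(1) by (simp add: compact_space_subtopology)
    show "Hausdorff_space ?X" by (rule Hausdorff_space_subtopology[OF Hausdorff_functions])
    fix f :: "('a \<Rightarrow> real) \<Rightarrow> real" assume "continuous_map ?X euclideanreal f"
    then have f: "continuous_on K f" by simp
    {
      fix c :: real
      have "\<bar>\<Lambda> (\<lambda>x. c * f x) - c * \<Lambda> f\<bar> \<le> 0 + e * (2 * \<bar>c\<bar> * L 1)" if e: "0 < e" for e
      proof -
        obtain a where a: "\<And>\<alpha>. \<alpha> \<in> K \<Longrightarrow> \<bar>f \<alpha> - \<alpha> a\<bar> \<le> e" using evaluations_dense[OF K f e] by blast
        have "\<bar>\<Lambda> (\<lambda>x. c * f x) - L (c *\<^sub>R a)\<bar> \<le> (\<bar>c\<bar> * e) * L 1"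
        proof (rule near)
          fix \<alpha> assume \<alpha>: "\<alpha> \<in> K"
          have "c * f \<alpha> - \<alpha> (c *\<^sub>R a) = c * (f \<alpha> - \<alpha> a)" by (simp add: linear_scale[OF lin[OF \<alpha>]] algebra_simps)
          then show "\<bar>c * f \<alpha> - \<alpha> (c *\<^sub>R a)\<bar> \<le> \<bar>c\<bar> * e" using a[OF \<alpha>] by (simp add: abs_mult mult_left_mono)
        qed
        moreover have "\<bar>c * \<Lambda> f - L (c *\<^sub>R a)\<bar> \<le> (\<bar>c\<bar> * e) * L 1"
        proof -
          have "c * \<Lambda> f - L (c *\<^sub>R a) = c * (\<Lambda> f - L a)" by (simp add: linear_scale[OF L] algebra_simps)
          then show ?thesis using near[of f a e, OF a] by (simp add: abs_mult mult_left_mono mult.assoc)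
        qed
        ultimately have "\<bar>\<Lambda> (\<lambda>x. c * f x) - c * \<Lambda> f\<bar> \<le> (\<bar>c\<bar> * e) * L 1 + (\<bar>c\<bar> * e) * L 1" by linarith
        then show ?thesis by (simp add: algebra_simps)
      qed
      then have "\<bar>\<Lambda> (\<lambda>x. c * f x) - c * \<Lambda> f\<bar> \<le> 0"
        by (rule vanish) (use L1 in auto)
      then show "\<Lambda> (\<lambda>x. c * f x) = c * \<Lambda> f" by simp
    next
      fix g :: "('a \<Rightarrow> real) \<Rightarrow> real" assume "continuous_map ?X euclideanreal g"
      then have g: "continuous_on K g" by simp
      have "\<bar>\<Lambda> (\<lambda>x. f x + g x) - (\<Lambda> f + \<Lambda> g)\<bar> \<le> 0 + e * (4 * L 1)" if e: "0 < e" for e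
      proof -
        obtain a where a: "\<And>\<alpha>. \<alpha> \<in> K \<Longrightarrow> \<bar>f \<alpha> - \<alpha> a\<bar> \<le> e" using evaluations_dense[OF K f e] by blast
        obtain b where b: "\<And>\<alpha>. \<alpha> \<in> K \<Longrightarrow> \<bar>g \<alpha> - \<alpha> b\<bar> \<le> e" using evaluations_dense[OF K g e] by blast
        have "\<bar>\<Lambda> (\<lambda>x. f x + g x) - L (a + b)\<bar> \<le> (2 * e) * L 1"
        proof (rule near)
          fix \<alpha> assume \<alpha>: "\<alpha> \<in> K"
          show "\<bar>f \<alpha> + g \<alpha> - \<alpha> (a + b)\<bar> \<le> 2 * e"
            using a[OF \<alpha>] b[OF \<alpha>] by (simp add: linear_add[OF lin[OF \<alpha>]])
        qed
        then have "\<bar>\<Lambda> (\<lambda>x. f x + g x) - (L a + L b)\<bar> \<le> 2 * (e * L 1)" by (simp add: linear_add[OF L])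
        with near[of f a e, OF a] near[of g b e, OF b] have "\<bar>\<Lambda> (\<lambda>x. f x + g x) - (\<Lambda> f + \<Lambda> g)\<bar> \<le> 4 * (e * L 1)" by linarith
        then show ?thesis by simp
      qed
      then have "\<bar>\<Lambda> (\<lambda>x. f x + g x) - (\<Lambda> f + \<Lambda> g)\<bar> \<le> 0"
        by (rule vanish) (use L1 in auto)
      then show "\<Lambda> (\<lambda>x. f x + g x) = \<Lambda> f + \<Lambda> g" by simp
    next
      fix g :: "('a \<Rightarrow> real) \<Rightarrow> real" assume "continuous_map ?X euclideanreal g"
        and le: "\<And>x. x \<in> topspace ?X \<Longrightarrow> f x \<le> g x"
      then have g: "continuous_on K g" by simp
      show "\<Lambda> f \<le> \<Lambda> g"
      proof (rule vanish)
        fix e :: real assume e: "0 < e"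
        obtain a where a: "\<And>\<alpha>. \<alpha> \<in> K \<Longrightarrow> \<bar>f \<alpha> - \<alpha> a\<bar> \<le> e" using evaluations_dense[OF K f e] by blast
        obtain b where b: "\<And>\<alpha>. \<alpha> \<in> K \<Longrightarrow> \<bar>g \<alpha> - \<alpha> b\<bar> \<le> e" using evaluations_dense[OF K g e] by blast
        have "L a \<le> L (b + (2 * e) *\<^sub>R 1)"
        proof (rule L_mono)
          fix \<alpha> assume \<alpha>: "\<alpha> \<in> K"
          have "\<alpha> (b + (2 * e) *\<^sub>R 1) = \<alpha> b + 2 * e"
            by (simp add: linear_add[OF lin[OF \<alpha>]] linear_scale[OF lin[OF \<alpha>]] one[OF \<alpha>])
          moreover have "f \<alpha> \<le> g \<alpha>" using le \<alpha> by simp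
          ultimately show "\<alpha> a \<le> \<alpha> (b + (2 * e) *\<^sub>R 1)" using a[OF \<alpha>] b[OF \<alpha>] by linarith
        qed
        then have "L a \<le> L b + 2 * (e * L 1)" by (simp add: linear_add[OF L] linear_scale[OF L])
        with near[of f a e, OF a] near[of g b e, OF b] have "\<Lambda> f \<le> \<Lambda> g + 4 * (e * L 1)" by linarith
        then show "\<Lambda> f \<le> \<Lambda> g + e * (4 * L 1)" by simp
      qed (use L1 in simp)
    }
  qed
  have radon: "radon_measure (subtopology character_space K) riesz_measure"
  proof -
    have eq: "subtopology character_space K = ?X"
      using K(2) by (simp add: character_space_eq subtopology_subtopology Int_absorb1)
    interpret finite_measure riesz_measure by (rule finite_measure_riesz)
    have "\<exists>U. openin ?X U \<and> x \<in> U \<and> emeasure riesz_measure U < \<infinity>" if "x \<in> topspace ?X" for x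
      using that emeasure_finite[of K] by (intro exI[of _ "topspace ?X"]) (simp flip: less_top)
    then show ?thesis
      unfolding eq radon_measure_def using emeasure_riesz_inner_regular by simp
  qed
  define N where "N = sigma (topspace character_space) {U. openin (character_space :: ('a \<Rightarrow> real) topology) U}"
  define \<mu> where "\<mu> = distr riesz_measure N (\<lambda>x. x)"
  have Hausdorff: "Hausdorff_space (character_space :: ('a \<Rightarrow> real) topology)"
    by (simp add: character_space_eq Hausdorff_space_subtopology[OF Hausdorff_functions])
  have KC: "compactin character_space K" using K by (simp add: compactin_character_space)
  note ext = radon_measure_extend[OF Hausdorff KC radon finite_measure_riesz, folded N_def, folded \<mu>_def]
  have "represented_by L \<mu>"
    unfolding represented_by_def
  proof (intro allI conjI)
    fix a
    have c: "continuous_map ?X euclideanreal (\<lambda>\<alpha>. \<alpha> a)"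
      unfolding continuous_map_iff_continuous
      by (rule continuous_on_subset[OF continuous_on_product_coordinates subset_UNIV])
    have c': "continuous_map character_space euclideanreal (\<lambda>\<alpha>. \<alpha> a)"
      unfolding character_space_eq continuous_map_iff_continuous
      by (rule continuous_on_subset[OF continuous_on_product_coordinates subset_UNIV])
    have opens: "{U. openin (character_space :: ('a \<Rightarrow> real) topology) U} \<subseteq> Pow (topspace character_space)"
      by (blast dest: openin_subset)
    have spN: "space N = characters"
      unfolding N_def space_measure_of[OF opens] by simp
    have meas: "(\<lambda>\<alpha>. \<alpha> a) \<in> borel_measurable N"
    proof (rule borel_measurableI)
      fix V :: "real set" assume "open V"
      then have "openin character_space {\<alpha> \<in> topspace character_space. \<alpha> a \<in> V}"
        using openin_continuous_map_preimage[OF c'] by simp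
      moreover have "{\<alpha> \<in> topspace character_space. \<alpha> a \<in> V} = (\<lambda>\<alpha>. \<alpha> a) -` V \<inter> space N"
        by (auto simp: spN)
      ultimately show "(\<lambda>\<alpha>. \<alpha> a) -` V \<inter> space N \<in> sets N"
        unfolding N_def sets_measure_of[OF opens] by (simp add: sigma_sets.Basic)
    qed
    show "integrable \<mu> (\<lambda>\<alpha>. \<alpha> a)"
      unfolding \<mu>_def using integrable_distr_eq[OF ext(3) meas] integrable_riesz[OF c] by simp
    have "(\<integral>\<alpha>. \<alpha> a \<partial>\<mu>) = \<Lambda> (\<lambda>\<alpha>. \<alpha> a)"
      unfolding \<mu>_def integral_distr[OF ext(3) meas] by (rule integral_riesz[OF c])
    also have "\<dots> = L a" using near[of "\<lambda>\<alpha>. \<alpha> a" a 0] by simp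
    finally show "L a = (\<integral>\<alpha>. \<alpha> a \<partial>\<mu>)" by simp
  qed
  with ext(1,2) show thesis by (intro that[of \<mu>]) auto
qed

theorem mainTheorem4:
  fixes \<tau> :: "'a::{real_algebra, comm_ring, comm_monoid_mult} topology"
    and F :: "('a \<Rightarrow> real) set"
    and d :: nat
    and S :: "'a set"
    and L :: "'a \<Rightarrow> real"
  assumes "lmc_topology \<tau>"
    and "saturated_family F"
    and "\<tau> = seminorm_topology F"
    and "d \<ge> 1"
    and "power_module d S"
    and "linear L"
    and "continuous_map \<tau> euclideanreal L"
    and "\<forall>s\<in>S. 0 \<le> L s"
  shows "(\<exists>!\<mu>. radon_measure character_space \<mu> \<and> represented_by L \<mu>) \<and>
    (\<forall>\<mu>. radon_measure character_space \<mu> \<and> represented_by L \<mu> \<longrightarrow>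
      (\<exists>\<rho>\<in>F. compactin character_space (nonneg_characters S \<inter> gelfand_spectrum \<rho>) \<and>
        measure_support character_space \<mu> \<subseteq> nonneg_characters S \<inter> gelfand_spectrum \<rho>))"
proof -
  obtain \<rho> C where \<rho>F: "\<rho> \<in> F" and C: "0 < C" "\<And>x. \<bar>L x\<bar> \<le> C * \<rho> x"
    using continuous_linear_functional_bounded[OF assms(2,6)] assms(3,7) by blast
  have \<rho>: "submult_seminorm \<rho>" using assms(2) \<rho>F by (simp add: saturated_family_def)
  define K where "K = nonneg_characters S \<inter> gelfand_spectrum \<rho>"
  have K_eq: "K = bounded_characters \<rho> \<inter> nonneg_characters S"
    by (auto simp: K_def gelfand_spectrum_eq[OF \<rho>])
  have K: "compact K" "K \<subseteq> characters"
    unfolding K_eq using compact_Int_closed[OF compact_bounded_characters closed_nonneg_characters]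
    by (auto simp: nonneg_characters_def)
  have "0 \<le> L a" if "\<And>\<alpha>. \<alpha> \<in> K \<Longrightarrow> 0 \<le> \<alpha> a" for a
    using functional_nonneg_of_nonneg_on_characters[OF \<rho> assms(4,5,6) C(2), of a] assms(8) that
    by (auto simp: K_eq)
  then obtain \<mu> where \<mu>: "radon_measure character_space \<mu>" "represented_by L \<mu>"
    "emeasure \<mu> (characters - K) = 0"
    using represented_by_measure_on_compact[OF K assms(6)] by blast
  have unique: "\<nu> = \<mu>" if \<nu>: "radon_measure character_space \<nu>" "represented_by L \<nu>" for \<nu>
  proof (rule concentrated_representing_measures_eq[OF \<nu> _ \<mu>(1,2)])
    show "emeasure \<nu> (characters - bounded_characters \<rho>) = 0"
      by (rule representing_measure_concentrated[OF \<nu> \<rho> C])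
    show "emeasure \<mu> (characters - bounded_characters \<rho>) = 0"
      by (rule representing_measure_concentrated[OF \<mu>(1,2) \<rho> C])
    show "compact (bounded_characters \<rho>)" by (rule compact_bounded_characters)
  qed (auto simp: bounded_characters_def)
  have support: "measure_support character_space \<mu> \<subseteq> K"
  proof
    fix \<alpha> assume \<alpha>: "\<alpha> \<in> measure_support character_space \<mu>"
    show "\<alpha> \<in> K"
    proof (rule ccontr)
      assume "\<alpha> \<notin> K"
      moreover have "openin character_space (characters - K)"
        using closedin_compact_characters[OF K] by (simp add: closedin_def)
      ultimately show False using \<alpha> \<mu>(3) by (auto simp: measure_support_def)
    qed
  qed
  have "compactin character_space K" using K by (simp add: compactin_character_space)
  with unique \<mu>(1,2) support \<rho>F show ?thesis unfolding K_def by blast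
qed

end
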